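(* Let $n\ge1$, let $X_1,\dots,X_n$ be independent and uniformly distributed on $[0,1]$, and let $X_{(1)}\ge\dots\ge X_{(n)}$ be their descending arrangement. Let $\vec Y=(Y_1,\dots,Y_n)$ be any rearrangement obtained by the construction with fixed positions, switching schemes and jump probabilities described in the context. Then $\vec Y$ has the strong rank independence property: for each $k=1,\dots,n-1$ the vector of initial ranks $(\mathfrak R_{k+1},\dots,\mathfrak R_n)$ is independent of $(Y_1,\dots,Y_k)$, where $\mathfrak R_j=1+\#\{i<j:Y_i>Y_j\}$.
   Context: Construction. Parameters: (Fixed positions) Choose $d$ and a subsequence $n_1<n_2<\dots<n_d$ of $\{1,\dots,n\}$; put $n_0=0$, $n_{d+1}=n+1$, and require $n_{i+1}-n_i\ne 2$ for $i=0,\dots,d$. For $i=1,\dots,d+1$ let $N_i=\{n_{i-1}+1,\dots,n_i-1\}$ (so each $N_i$ is empty or has at least two elements). (Switching schemes) Choose $d$ distinct positions $m_1,\dots,m_d\in\{1,\dots,n\}$, and partition the remaining elements of $\{1,\dots,n\}$ into subsets $M_1,\dots,M_{d+1}$ with $\#M_i=\#N_i$ for $i=1,\dots,d+1$. (Jump probabilities) For each $i$ with $N_i\neq\emptyset$ choose $\theta_i\in(0,1)$. For $\theta\in(0,1)$ let $f_\theta:[0,1]\to[0,1]$ be $f_\theta(x)=\frac{\theta-x}{\theta}$ for $0\le x\le\theta$, and $f_\theta(x)=\frac{x-\theta}{1-\theta}$ for $\theta\le x\le1$. The rearrangement is $\vec Y=(X_{(\mu_1)},\dots,X_{(\mu_n)})$,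 where the random permutation $\mu$ is the (almost surely unique) function of $(X_{(1)},\dots,X_{(n)})$ determined as follows, with the conventions $X_{(0)}=1$, $X_{(n+1)}=0$: 1. $\mu_{m_i}=n_i$, $i=1,\dots,d$ (so $Y_{m_i}=X_{(n_i)}$); 2. $j\in M_i$ if and only if $\mu_j\in N_i$ (so $\{Y_j:j\in M_i\}=\{X_{(j)}:j\in N_i\}$), $i=1,\dots,d+1$; 3. if $N_i\ne\emptyset$, let $I_i=[X_{(n_i)},X_{(n_{i-1})}]$, let $\gamma_i:I_i\to[0,1]$ be the affine orientation-preserving bijection, and $f_i=f_{\theta_i}\circ\gamma_i$; writing $M_i=\{j_1<j_2<\dots<j_\ell\}$, the values $\mu_{j_1},\dots,\mu_{j_\ell}\in N_i$ are determined by $$f_i(X_{(\mu_{j_1})})<f_i(X_{(\mu_{j_2})})<\dots<f_i(X_{(\mu_{j_\ell})}).$$ *)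

theory Defs
  imports "HOL-Probability.Probability"
begin

text \<open>Vectors of length \<open>n\<close> are functions on \<open>nat\<close>, read at the indices \<open>1..n\<close>.\<close>

text \<open>\<open>order_stat n x j\<close> is the \<open>j\<close>-th largest of \<open>x 1, ..., x n\<close>, extended by the value
  1 at index 0 and the value 0 at index \<open>n + 1\<close>.\<close>

definition order_stat :: "nat \<Rightarrow> (nat \<Rightarrow> real) \<Rightarrow> nat \<Rightarrow> real" where
  "order_stat n x j =
    (if j = 0 then 1
     else if j \<le> n then rev (sort (map x [1..<n + 1])) ! (j - 1)
     else 0)"

definition blockN :: "(nat \<Rightarrow> nat) \<Rightarrow> nat \<Rightarrow> nat set" where
  "blockN p i = {p (i - 1)<..<p i}"

text \<open>\<open>p 1 < ... < p d\<close> are the fixed positions, with the sentinels \<open>p 0 = 0\<close> and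
  \<open>p (d + 1) = n + 1\<close>; the case \<open>d = 0\<close> is allowed.\<close>

definition fixed_positions :: "nat \<Rightarrow> nat \<Rightarrow> (nat \<Rightarrow> nat) \<Rightarrow> bool" where
  "fixed_positions n d p \<longleftrightarrow>
     p 0 = 0 \<and> p (d + 1) = n + 1 \<and> strict_mono_on {0..d + 1} p \<and>
     (\<forall>i\<in>{0..d}. p (i + 1) - p i \<noteq> 2)"

definition switching_scheme ::
    "nat \<Rightarrow> nat \<Rightarrow> (nat \<Rightarrow> nat) \<Rightarrow> (nat \<Rightarrow> nat) \<Rightarrow> (nat \<Rightarrow> nat set) \<Rightarrow> bool" where
  "switching_scheme n d p m B \<longleftrightarrow>
     inj_on m {1..d} \<and> m ` {1..d} \<subseteq> {1..n} \<and>
     disjoint_family_on B {1..d + 1} \<and>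
     (\<Union>i\<in>{1..d + 1}. B i) = {1..n} - m ` {1..d} \<and>
     (\<forall>i\<in>{1..d + 1}. card (B i) = card (blockN p i))"

definition jump_probabilities :: "nat \<Rightarrow> (nat \<Rightarrow> nat) \<Rightarrow> (nat \<Rightarrow> real) \<Rightarrow> bool" where
  "jump_probabilities d p \<theta> \<longleftrightarrow>
     (\<forall>i\<in>{1..d + 1}. blockN p i \<noteq> {} \<longrightarrow> \<theta> i \<in> {0<..<1})"

definition jump_fun :: "real \<Rightarrow> real \<Rightarrow> real" where
  "jump_fun t x = (if x \<le> t then (t - x) / t else (x - t) / (1 - t))"

text \<open>The increasing affine map of \<open>{a..b}\<close> onto \<open>{0..1}\<close> (for \<open>a < b\<close>).\<close>

definition affine_unit :: "real \<Rightarrow> real \<Rightarrow> real \<Rightarrow> real" where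
  "affine_unit a b x = (x - a) / (b - a)"

text \<open>Here \<open>s\<close> is a decreasing vector together with the boundary values \<open>s 0 = 1\<close> and
  \<open>s (n + 1) = 0\<close>, so block \<open>i\<close> occupies the interval \<open>{s (p i)..s (p (i - 1))}\<close>.\<close>

definition block_jump ::
    "(nat \<Rightarrow> nat) \<Rightarrow> (nat \<Rightarrow> real) \<Rightarrow> (nat \<Rightarrow> real) \<Rightarrow> nat \<Rightarrow> real \<Rightarrow> real" where
  "block_jump p \<theta> s i = jump_fun (\<theta> i) \<circ> affine_unit (s (p i)) (s (p (i - 1)))"

definition rearranging_perm ::
    "nat \<Rightarrow> nat \<Rightarrow> (nat \<Rightarrow> nat) \<Rightarrow> (nat \<Rightarrow> nat) \<Rightarrow> (nat \<Rightarrow> nat set) \<Rightarrow> (nat \<Rightarrow> real) \<Rightarrow>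
     (nat \<Rightarrow> real) \<Rightarrow> (nat \<Rightarrow> nat) \<Rightarrow> bool" where
  "rearranging_perm n d p m B \<theta> s \<mu> \<longleftrightarrow>
     bij_betw \<mu> {1..n} {1..n} \<and>
     (\<forall>i\<in>{1..d}. \<mu> (m i) = p i) \<and>
     (\<forall>i\<in>{1..d + 1}. \<forall>j\<in>{1..n}. j \<in> B i \<longleftrightarrow> \<mu> j \<in> blockN p i) \<and>
     (\<forall>i\<in>{1..d + 1}. blockN p i \<noteq> {} \<longrightarrow>
        (\<forall>j\<in>B i. \<forall>j'\<in>B i. j < j' \<longrightarrow>
           block_jump p \<theta> s i (s (\<mu> j)) < block_jump p \<theta> s i (s (\<mu> j'))))"

definition initial_rank :: "(nat \<Rightarrow> real) \<Rightarrow> nat \<Rightarrow> nat" where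
  "initial_rank y j = 1 + card {i \<in> {1..<j}. y i > y j}"

text \<open>The ranks are embedded into the reals because \<open>indep_var\<close> requires both random elements to
  have values in the same type; they generate the same sigma-algebra as with discrete codomain.\<close>

definition strong_rank_independence :: "'a measure \<Rightarrow> nat \<Rightarrow> (nat \<Rightarrow> 'a \<Rightarrow> real) \<Rightarrow> bool" where
  "strong_rank_independence M n Y \<longleftrightarrow>
     (\<forall>k\<in>{1..n - 1}.
        prob_space.indep_var M
          (\<Pi>\<^sub>M j\<in>{k + 1..n}. borel)
          (\<lambda>\<omega>. \<lambda>j\<in>{k + 1..n}. real (initial_rank (\<lambda>i. Y i \<omega>) j))
          (\<Pi>\<^sub>M j\<in>{1..k}. borel)
          (\<lambda>\<omega>. \<lambda>j\<in>{1..k}. Y j \<omega>))"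

end

theory Submission
  imports Defs "HOL-Combinatorics.Permutations"
begin

text \<open>
  Almost surely exactly one permutation of the sample satisfies the constraints of the construction
  (call such vectors admissible), so the law of \<open>Y\<close> is \<open>n!\<close> times the uniform law on the cube
  restricted to the admissible vectors. For \<open>j\<close> in the block \<open>i\<close>, once all other
  coordinates are fixed, admissibility constrains \<open>Y j\<close> only through the value of the jump function;
  hence \<open>Y j\<close> lies left of the jump point with conditional probability \<open>\<theta> i\<close>. So the left/right
  choices at the times after \<open>k\<close> are independent of each other and of \<open>Y 1, ..., Y k\<close>. They also
  determine the ranks after \<open>k\<close>: comparisons between different cells are prescribed by the scheme, and
  within a block every new value lies outside the range of the earlier ones, below all of them if
  it is on the left and above all of them if it is on the right.
\<close>

text \<open>The permutation \<open>\<mu>\<close> sees the whole sample, and the interval of a block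
  may end at junction values that \<open>Y\<close> reveals only later, so the sides cannot be
  analysed by revealing \<open>Y\<close> step by step. Restating the constraints for a vector
  \<open>y\<close> alone removes \<open>\<mu>\<close> and the order statistics. Under the product
  law coordinate \<open>j\<close> can then be integrated with every other coordinate held fixed,
  later ones included. The resulting factor \<open>\<theta> i\<close> does not depend on the
  coordinates held fixed; this is what makes the weight of a left/right pattern a plain product and
  lets an arbitrary event about the first \<open>k\<close> values pass through. That some reordering
  of the sample is admissible is supplied by \<open>\<mu>\<close> itself, so only uniqueness has to
  be proved.\<close>

abbreviation unif :: "real measure" where
  "unif \<equiv> uniform_measure lborel {0..1}"

section \<open>The uniform law and one-coordinate slices of product measures\<close>

lemma prob_space_unif: "prob_space unif"
  by (rule prob_space_uniform_measure) auto

lemma emeasure_unif: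
  assumes "A \<in> sets borel" "A \<subseteq> {0..1}"
  shows "emeasure unif A = emeasure lborel A"
  using assms by (simp add: Int_absorb1 divide_ennreal_def)

text \<open>Fubini in the single coordinate \<open>j\<close>, phrased with \<open>x(j := t)\<close>
  so that a predicate on full vectors never has to be split into two arguments.\<close>

lemma (in product_sigma_finite) emeasure_PiM_slice:
  assumes fin: "finite I" and j: "j \<in> I" and P: "Measurable.pred (Pi\<^sub>M I M) P"
  shows "emeasure (Pi\<^sub>M I M) {x \<in> space (Pi\<^sub>M I M). P x} =
    (\<integral>\<^sup>+ x. emeasure (M j) {t \<in> space (M j). P (x(j := t))} \<partial>Pi\<^sub>M (I - {j}) M)"
proof -
  have I: "insert j (I - {j}) = I" using j by auto
  let ?A = "{x \<in> space (Pi\<^sub>M I M). P x}"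
  have A: "?A \<in> sets (Pi\<^sub>M I M)" using P by (simp add: pred_def)
  have upd: "x(j := t) \<in> space (Pi\<^sub>M I M)" if "x \<in> space (Pi\<^sub>M (I - {j}) M)" "t \<in> space (M j)" for x t
    using that j by (auto simp: space_PiM PiE_iff extensional_def)
  have "emeasure (Pi\<^sub>M I M) ?A = (\<integral>\<^sup>+ x. indicator ?A x \<partial>Pi\<^sub>M I M)"
    using A by simp
  also have "\<dots> = (\<integral>\<^sup>+ x. (\<integral>\<^sup>+ t. indicator ?A (x(j := t)) \<partial>M j) \<partial>Pi\<^sub>M (I - {j}) M)"
    using product_nn_integral_insert[of "I - {j}" j "indicator ?A"] fin A unfolding I by simp
  also have "\<dots> = (\<integral>\<^sup>+ x. emeasure (M j) {t \<in> space (M j). P (x(j := t))} \<partial>Pi\<^sub>M (I - {j}) M)"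
  proof (rule nn_integral_cong)
    fix x assume x: "x \<in> space (Pi\<^sub>M (I - {j}) M)"
    have "(\<lambda>t. x(j := t)) \<in> measurable (M j) (Pi\<^sub>M I M)"
      using measurable_fun_upd[of I "I - {j}" j "\<lambda>_. x" "M j" M "\<lambda>t. t"] x I by simp
    from measurable_sets[OF this A]
    have S: "{t \<in> space (M j). P (x(j := t))} \<in> sets (M j)"
      by (rule back_subst[where P = "\<lambda>S. S \<in> sets (M j)"]) (use upd[OF x] in auto)
    have "(\<integral>\<^sup>+ t. indicator ?A (x(j := t)) \<partial>M j) = (\<integral>\<^sup>+ t. indicator {t \<in> space (M j). P (x(j := t))} t \<partial>M j)"
      by (intro nn_integral_cong) (use upd[OF x] in \<open>auto simp: indicator_def\<close>)
    then show "(\<integral>\<^sup>+ t. indicator ?A (x(j := t)) \<partial>M j) = emeasure (M j) {t \<in> space (M j). P (x(j := t))}"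
      using S by simp
  qed
  finally show ?thesis .
qed

lemma (in product_sigma_finite) measurable_PiM_slice:
  assumes fin: "finite I" and j: "j \<in> I" and P: "Measurable.pred (Pi\<^sub>M I M) P"
  shows "(\<lambda>x. emeasure (M j) {t \<in> space (M j). P (x(j := t))}) \<in> borel_measurable (Pi\<^sub>M (I - {j}) M)"
proof -
  let ?A = "{z \<in> space (Pi\<^sub>M (I - {j}) M \<Otimes>\<^sub>M M j). P ((fst z)(j := snd z))}"
  have "(\<lambda>z. (fst z)(j := snd z)) \<in> measurable (Pi\<^sub>M (I - {j}) M \<Otimes>\<^sub>M M j) (Pi\<^sub>M I M)"
    using j by (intro measurable_fun_upd[of _ "I - {j}"]) auto
  from measurable_compose[OF this P] have "?A \<in> sets (Pi\<^sub>M (I - {j}) M \<Otimes>\<^sub>M M j)"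
    by (simp add: pred_def)
  then show ?thesis
    by (intro sigma_finite_measure.measurable_emeasure[OF sigma_finite_measures])
      (auto elim!: back_subst[where P = "\<lambda>S. S \<in> sets (Pi\<^sub>M (I - {j}) M \<Otimes>\<^sub>M M j)"] simp: space_pair_measure)
qed

text \<open>Provides the strict inequalities behind admissibility: sample values differ from each
  other and from the end values 0 and 1. Each exceptional set is null because its slices in one
  coordinate meet the unit interval in at most two points.\<close>

lemma AE_PiM_unif_distinct:
  assumes "finite I"
  shows "AE x in Pi\<^sub>M I (\<lambda>_. unif). (\<forall>i\<in>I. 0 < x i \<and> x i < 1) \<and> inj_on x I"
proof -
  interpret prob_space unif by (rule prob_space_unif)
  interpret product_sigma_finite "\<lambda>_. unif" by standard
  have sets[measurable_cong]: "sets (Pi\<^sub>M I (\<lambda>_. unif)) = sets (Pi\<^sub>M I (\<lambda>_. borel))"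
    by (intro sets_PiM_cong) auto
  have comp: "(\<lambda>x. x i) \<in> borel_measurable (Pi\<^sub>M I (\<lambda>_. unif))" if "i \<in> I" for i
    using that by measurable
  have 1: "AE x in Pi\<^sub>M I (\<lambda>_. unif). 0 < x i \<and> x i < 1" if i: "i \<in> I" for i
  proof (rule AE_I')
    have P[measurable]: "Measurable.pred (Pi\<^sub>M I (\<lambda>_. unif)) (\<lambda>x. \<not> (0 < x i \<and> x i < 1))"
      using i by measurable
    have "emeasure unif {t. \<not> (0 < t \<and> t < 1)} = emeasure lborel ({0..1} \<inter> {t::real. \<not> (0 < t \<and> t < 1)})"
      by (simp add: divide_ennreal_def)
    also have "{0..1} \<inter> {t. \<not> (0 < t \<and> t < 1)} = {0, 1::real}" by auto
    finally have *: "emeasure unif {t. 0 < t \<longrightarrow> \<not> t < 1} = 0"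
      by (simp add: emeasure_lborel_countable)
    have "emeasure (Pi\<^sub>M I (\<lambda>_. unif)) {x \<in> space (Pi\<^sub>M I (\<lambda>_. unif)). \<not> (0 < x i \<and> x i < 1)} = 0"
      unfolding emeasure_PiM_slice[OF assms i P] by (simp del: emeasure_uniform_measure add: *)
    then show "{x \<in> space (Pi\<^sub>M I (\<lambda>_. unif)). \<not> (0 < x i \<and> x i < 1)} \<in> null_sets (Pi\<^sub>M I (\<lambda>_. unif))"
      by (intro null_setsI) measurable
  qed auto
  have 2: "AE x in Pi\<^sub>M I (\<lambda>_. unif). x i \<noteq> x j" if i: "i \<in> I" and j: "j \<in> I" and "i \<noteq> j" for i j
  proof (rule AE_I')
    have P: "Measurable.pred (Pi\<^sub>M I (\<lambda>_. unif)) (\<lambda>x. x i = x j)"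
      unfolding pred_def by (intro borel_measurable_eq comp i j)
    have *: "emeasure unif {s} = 0" for s :: real
    proof -
      have "emeasure unif {s} = emeasure lborel ({0..1} \<inter> {s})"
        by (simp add: divide_ennreal_def)
      also have "\<dots> \<le> emeasure lborel {s}" by (intro emeasure_mono) auto
      finally show ?thesis by simp
    qed
    have "emeasure (Pi\<^sub>M I (\<lambda>_. unif)) {x \<in> space (Pi\<^sub>M I (\<lambda>_. unif)). x i = x j} = 0"
      unfolding emeasure_PiM_slice[OF assms j P] using \<open>i \<noteq> j\<close> by (simp del: emeasure_uniform_measure add: *)
    then show "{x \<in> space (Pi\<^sub>M I (\<lambda>_. unif)). x i = x j} \<in> null_sets (Pi\<^sub>M I (\<lambda>_. unif))"
      using P by (intro null_setsI) (simp_all add: pred_def)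
  qed auto
  have "AE x in Pi\<^sub>M I (\<lambda>_. unif). \<forall>i\<in>I. 0 < x i \<and> x i < 1"
    using 1 assms by (intro AE_finite_allI) auto
  moreover have "AE x in Pi\<^sub>M I (\<lambda>_. unif). \<forall>i\<in>I. \<forall>j\<in>I. i \<noteq> j \<longrightarrow> x i \<noteq> x j"
    using 2 assms by (intro AE_finite_allI) (auto intro: AE_I2)
  ultimately show ?thesis
    by eventually_elim (auto simp: inj_on_def)
qed

section \<open>Order statistics as sorted sample values, and their measurability\<close>

lemma order_stat_antimono:
  assumes "l \<in> {1..n}" "l' \<in> {1..n}" "l \<le> l'"
  shows "order_stat n x l' \<le> order_stat n x l"
proof -
  have "sorted (rev (rev (sort (map x [1..<n + 1]))))" by simp
  from sorted_rev_nth_mono[OF this, of "l - 1" "l' - 1"] assms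
  show ?thesis by (simp add: order_stat_def del: upt_Suc)
qed

lemma order_stat_permutation:
  obtains \<tau> where "\<tau> permutes {1..n}" "\<forall>l\<in>{1..n}. order_stat n x l = x (\<tau> l)"
proof -
  let ?xs = "map x [1..<n + 1]"
  let ?ys = "rev (sort ?xs)"
  have "mset ?ys = mset ?xs" by simp
  then obtain q where q: "q permutes {..<length ?xs}" "permute_list q ?xs = ?ys"
    by (rule mset_eq_permutation)
  have len: "length ?xs = n" by simp
  \<comment> \<open>Lists are indexed from 0 and order statistics from 1; outside
    \<open>{1..n}\<close> the identity is what \<open>permutes\<close> demands.\<close>
  define \<tau> where "\<tau> l = (if l \<in> {1..n} then Suc (q (l - 1)) else l)" for l
  have qn: "q k < n" if "k < n" for k
    using permutes_in_image[OF q(1), of k] that len by simp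
  have "bij_betw \<tau> {1..n} {1..n}"
  proof (rule bij_betw_imageI)
    show inj: "inj_on \<tau> {1..n}"
    proof (rule inj_onI)
      fix a b assume ab: "a \<in> {1..n}" "b \<in> {1..n}" "\<tau> a = \<tau> b"
      then have "q (a - 1) = q (b - 1)" by (simp add: \<tau>_def)
      then have "a - 1 = b - 1" using permutes_inj[OF q(1)] by (simp add: inj_eq)
      then show "a = b" using ab by auto
    qed
    have "\<tau> ` {1..n} \<subseteq> {1..n}"
    proof (rule image_subsetI)
      fix a assume "a \<in> {1..n}"
      then show "\<tau> a \<in> {1..n}" using qn[of "a - 1"] by (auto simp: \<tau>_def Suc_le_eq)
    qed
    then show "\<tau> ` {1..n} = {1..n}" using inj by (simp add: endo_inj_surj)
  qed
  then have "\<tau> permutes {1..n}"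
    by (rule bij_imp_permutes) (auto simp: \<tau>_def)
  moreover have "\<forall>l\<in>{1..n}. order_stat n x l = x (\<tau> l)"
  proof
    fix l assume l: "l \<in> {1..n}"
    have l1: "l - 1 < n" using l by auto
    have "order_stat n x l = ?ys ! (l - 1)" using l by (simp add: order_stat_def)
    also have "\<dots> = ?xs ! q (l - 1)"
      using permute_list_nth[OF q(1), of "l - 1"] l1 q(2) len by (simp del: upt_Suc)
    also have "\<dots> = x (\<tau> l)" using qn[OF l1] l by (simp add: \<tau>_def del: upt_Suc)
    finally show "order_stat n x l = x (\<tau> l)" .
  qed
  ultimately show ?thesis by (rule that)
qed

text \<open>Sorting is replaced by counting so that measurability becomes visible: the right-hand
  side is a finite union, over index sets of size \<open>l\<close>, of finite intersections. The
  first \<open>l\<close> sorted positions serve as \<open>T\<close>; conversely, \<open>l\<close>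
  indices do not fit into the \<open>l - 1\<close> positions before \<open>l\<close>.\<close>

lemma order_stat_greater_iff:
  assumes l: "l \<in> {1..n}"
  shows "a < order_stat n x l \<longleftrightarrow> (\<exists>T\<in>{T. T \<subseteq> {1..n} \<and> card T = l}. \<forall>i\<in>T. a < x i)"
proof -
  obtain \<tau> where \<tau>: "\<tau> permutes {1..n}"
    and x: "\<forall>l\<in>{1..n}. order_stat n x l = x (\<tau> l)"
    by (rule order_stat_permutation)
  note mono = order_stat_antimono[of _ n _ x]
  have inj: "inj_on \<tau> S" for S by (rule permutes_inj_on[OF \<tau>])
  show ?thesis
  proof
    assume a: "a < order_stat n x l"
    have "a < x (\<tau> i)" if "i \<in> {1..l}" for i
      using mono[of i l] bspec[OF x, of i] a that l by auto
    then have "\<forall>i\<in>\<tau> ` {1..l}. a < x i" by blast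
    moreover have "\<tau> ` {1..l} \<subseteq> \<tau> ` {1..n}" using l by (intro image_mono) auto
    then have "\<tau> ` {1..l} \<subseteq> {1..n}" by (simp only: permutes_image[OF \<tau>])
    moreover have "card (\<tau> ` {1..l}) = l" by (simp add: card_image[OF inj])
    ultimately show "\<exists>T\<in>{T. T \<subseteq> {1..n} \<and> card T = l}. \<forall>i\<in>T. a < x i"
      by (intro bexI[of _ "\<tau> ` {1..l}"]) simp_all
  next
    assume "\<exists>T\<in>{T. T \<subseteq> {1..n} \<and> card T = l}. \<forall>i\<in>T. a < x i"
    then obtain T where T: "T \<subseteq> {1..n}" "card T = l" "\<And>i. i \<in> T \<Longrightarrow> a < x i" by auto
    show "a < order_stat n x l"
    proof (rule ccontr)
      assume na: "\<not> a < order_stat n x l"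
      have "T \<subseteq> \<tau> ` {1..<l}"
      proof
        fix i assume i: "i \<in> T"
        then have "i \<in> \<tau> ` {1..n}" using T(1) permutes_image[OF \<tau>] by blast
        then obtain k where k: "k \<in> {1..n}" "i = \<tau> k" by blast
        have "k < l"
        proof (rule ccontr)
          assume "\<not> k < l"
          then have "order_stat n x k \<le> order_stat n x l" using mono[of l k] k l by simp
          then show False using T(3)[OF i] na bspec[OF x k(1)] k(2) by auto
        qed
        then show "i \<in> \<tau> ` {1..<l}" using k by auto
      qed
      then have "card T \<le> card (\<tau> ` {1..<l})" by (intro card_mono) auto
      also have "\<dots> = l - 1" by (simp add: card_image[OF inj])
      finally show False using T(2) l by auto
    qed
  qed
qed

lemma borel_measurable_order_stat:
  assumes [measurable]: "\<And>i. i \<in> {1..n} \<Longrightarrow> X i \<in> borel_measurable M"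
  shows "(\<lambda>\<omega>. order_stat n (\<lambda>i. X i \<omega>) l) \<in> borel_measurable M"
proof (cases "l \<in> {1..n}")
  case True
  have fin: "finite {T. T \<subseteq> {1..n} \<and> card T = l}" by (rule finite_subset[of _ "Pow {1..n}"]) auto
  show ?thesis
    unfolding borel_measurable_iff_greater
  proof
    fix a
    have "{\<omega> \<in> space M. \<exists>T\<in>{T. T \<subseteq> {1..n} \<and> card T = l}. \<forall>i\<in>T. a < X i \<omega>} \<in> sets M"
    proof (intro sets.sets_Collect_finite_Ex fin sets.sets_Collect_finite_All)
      fix T i assume T: "T \<in> {T. T \<subseteq> {1..n} \<and> card T = l}"
      then show "finite T" by (auto intro: finite_subset)
      assume "i \<in> T"
      with T have [measurable]: "X i \<in> borel_measurable M" using assms by blast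
      show "{\<omega> \<in> space M. a < X i \<omega>} \<in> sets M" by measurable
    qed
    then show "{\<omega> \<in> space M. a < order_stat n (\<lambda>i. X i \<omega>) l} \<in> sets M"
      by (simp only: order_stat_greater_iff[OF True])
  qed
next
  case False
  then have "(\<lambda>\<omega>. order_stat n (\<lambda>i. X i \<omega>) l) = (\<lambda>_. if l = 0 then 1 else 0)"
    unfolding order_stat_def using False by (intro ext) simp
  then show ?thesis by simp
qed

text \<open>\<open>jump_fun \<theta>\<close> maps both \<open>{0..\<theta>}\<close> and \<open>{\<theta>..1}\<close> affinely onto the unit interval, so a
  preimage splits in the ratio \<open>\<theta> : 1 - \<theta>\<close>.\<close>

lemma emeasure_jump_window:
  fixes lo hi \<theta> :: real
  assumes lo: "0 \<le> lo" "lo < hi" "hi \<le> 1" and \<theta>: "0 < \<theta>" "\<theta> < 1" and W: "W \<in> sets borel"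
  defines "g \<equiv> affine_unit lo hi"
  defines "S \<equiv> {t. lo < t \<and> t < hi \<and> jump_fun \<theta> (g t) \<in> W}"
  shows "emeasure unif {t. t \<in> S \<and> g t \<le> \<theta>} = ennreal \<theta> * emeasure unif S"
proof -
  have [measurable]: "g \<in> borel_measurable borel" "jump_fun \<theta> \<in> borel_measurable borel"
    unfolding g_def affine_unit_def[abs_def] jump_fun_def[abs_def] by measurable
  note W[measurable]
  have [measurable]: "S \<in> sets borel" unfolding S_def by measurable
  \<comment> \<open>\<open>?w\<close> is the size of the window measured in jump values. Each branch
    has to reproduce it, scaled by \<open>c * \<theta>\<close> on the left and by
    \<open>c * (1 - \<theta>)\<close> on the right.\<close>
  let ?w = "\<integral>\<^sup>+ u. indicator (W \<inter> {0<..<1}) u \<partial>lborel"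
  define c where "c = hi - lo"
  have c: "c > 0" using lo by (simp add: c_def)
  have gt: "g (lo + c * u) = u" for u using c by (simp add: g_def affine_unit_def c_def)
  have left: "emeasure lborel {t. t \<in> S \<and> g t \<le> \<theta>} = ennreal (c * \<theta>) * ?w"
  proof -
    have "emeasure lborel {t. t \<in> S \<and> g t \<le> \<theta>} = (\<integral>\<^sup>+ t. indicator {t. t \<in> S \<and> g t \<le> \<theta>} t \<partial>lborel)"
      by simp
    \<comment> \<open>The substitution inverts the left branch: \<open>u\<close> is the jump value,
      and the point moves down from the jump point at \<open>u = 0\<close> to \<open>lo\<close> at
      \<open>u = 1\<close>.\<close>
    also have "\<dots> = ennreal (c * \<theta>) *
        (\<integral>\<^sup>+ u. indicator {t. t \<in> S \<and> g t \<le> \<theta>} ((lo + c * \<theta>) + (- (c * \<theta>)) * u) \<partial>lborel)"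
      using c \<theta> by (subst nn_integral_real_affine[where c = "- (c * \<theta>)" and t = "lo + c * \<theta>"]) auto
    also have "(\<integral>\<^sup>+ u. indicator {t. t \<in> S \<and> g t \<le> \<theta>} ((lo + c * \<theta>) + (- (c * \<theta>)) * u) \<partial>lborel) = ?w"
    \<comment> \<open>The jump point \<open>u = 0\<close> counts as left but is outside
      \<open>{0<..<1}\<close>, so the integrands may differ at this one null point. The right branch
      excludes it and needs no exception.\<close>
    proof (rule nn_integral_cong_AE, use AE_lborel_singleton[of 0] in eventually_elim)
      fix u :: real assume u: "u \<noteq> 0"
      have e: "(lo + c * \<theta>) + (- (c * \<theta>)) * u = lo + c * (\<theta> - \<theta> * u)" by (simp add: algebra_simps)
      have a: "g (lo + c * (\<theta> - \<theta> * u)) = \<theta> - \<theta> * u" by (rule gt)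
      have b: "lo < lo + c * (\<theta> - \<theta> * u) \<longleftrightarrow> u < 1"
        using c \<theta> by (simp add: zero_less_mult_iff mult_less_cancel_left_pos right_diff_distrib[symmetric])
      have d: "\<theta> - \<theta> * u \<le> \<theta> \<longleftrightarrow> 0 \<le> u" using \<theta> by (simp add: zero_le_mult_iff)
      have f: "lo + c * (\<theta> - \<theta> * u) < hi" if "0 \<le> u"
      proof -
        have "\<theta> - \<theta> * u < 1" using d that \<theta> by linarith
        then have "c * (\<theta> - \<theta> * u) < c * 1" using c by (intro mult_strict_left_mono)
        then show ?thesis by (simp add: c_def)
      qed
      have h: "jump_fun \<theta> (\<theta> - \<theta> * u) = u" if "0 \<le> u" using that d \<theta> by (simp add: jump_fun_def)
      have "(lo + c * \<theta>) + (- (c * \<theta>)) * u \<in> S \<and> g ((lo + c * \<theta>) + (- (c * \<theta>)) * u) \<le> \<theta>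
          \<longleftrightarrow> u \<in> W \<inter> {0<..<1}"
        unfolding e S_def mem_Collect_eq a b using d f h u by auto
      then show "indicator {t. t \<in> S \<and> g t \<le> \<theta>} ((lo + c * \<theta>) + (- (c * \<theta>)) * u)
          = (indicator (W \<inter> {0<..<1}) u :: ennreal)" by (auto simp: indicator_def)
    qed
    finally show ?thesis .
  qed
  have right: "emeasure lborel {t. t \<in> S \<and> \<not> g t \<le> \<theta>} = ennreal (c * (1 - \<theta>)) * ?w"
  proof -
    have "emeasure lborel {t. t \<in> S \<and> \<not> g t \<le> \<theta>} = (\<integral>\<^sup>+ t. indicator {t. t \<in> S \<and> \<not> g t \<le> \<theta>} t \<partial>lborel)"
      by simp
    also have "\<dots> = ennreal (c * (1 - \<theta>)) *
        (\<integral>\<^sup>+ u. indicator {t. t \<in> S \<and> \<not> g t \<le> \<theta>} ((lo + c * \<theta>) + (c * (1 - \<theta>)) * u) \<partial>lborel)"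
      using c \<theta> by (subst nn_integral_real_affine[where c = "c * (1 - \<theta>)" and t = "lo + c * \<theta>"]) auto
    also have "(\<integral>\<^sup>+ u. indicator {t. t \<in> S \<and> \<not> g t \<le> \<theta>} ((lo + c * \<theta>) + (c * (1 - \<theta>)) * u) \<partial>lborel) = ?w"
    proof (rule nn_integral_cong)
      fix u :: real
      have e: "(lo + c * \<theta>) + (c * (1 - \<theta>)) * u = lo + c * (\<theta> + (1 - \<theta>) * u)" by (simp add: algebra_simps)
      have a: "g (lo + c * (\<theta> + (1 - \<theta>) * u)) = \<theta> + (1 - \<theta>) * u" by (rule gt)
      have d: "\<theta> + (1 - \<theta>) * u \<le> \<theta> \<longleftrightarrow> u \<le> 0" using \<theta> by (simp add: mult_le_0_iff)
      have b: "lo + c * (\<theta> + (1 - \<theta>) * u) < hi \<longleftrightarrow> u < 1"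
      proof -
        have "lo + c * (\<theta> + (1 - \<theta>) * u) < hi \<longleftrightarrow> c * (\<theta> + (1 - \<theta>) * u) < c * 1" by (auto simp: c_def)
        also have "\<dots> \<longleftrightarrow> \<theta> + (1 - \<theta>) * u < 1" using c by (simp only: mult_less_cancel_left_pos)
        also have "\<dots> \<longleftrightarrow> (1 - \<theta>) * u < (1 - \<theta>) * 1" by auto
        also have "\<dots> \<longleftrightarrow> u < 1" using \<theta> by (subst mult_less_cancel_left_pos) auto
        finally show ?thesis .
      qed
      have f: "lo < lo + c * (\<theta> + (1 - \<theta>) * u)" if "0 < u" using c \<theta> that by (simp add: add_pos_pos)
      have h: "jump_fun \<theta> (\<theta> + (1 - \<theta>) * u) = u" if "0 < u" using that d \<theta> by (simp add: jump_fun_def)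
      have "(lo + c * \<theta>) + (c * (1 - \<theta>)) * u \<in> S \<and> \<not> g ((lo + c * \<theta>) + (c * (1 - \<theta>)) * u) \<le> \<theta>
          \<longleftrightarrow> u \<in> W \<inter> {0<..<1}"
        unfolding e S_def mem_Collect_eq a b using d f h by auto
      then show "indicator {t. t \<in> S \<and> \<not> g t \<le> \<theta>} ((lo + c * \<theta>) + (c * (1 - \<theta>)) * u)
          = (indicator (W \<inter> {0<..<1}) u :: ennreal)" by (auto simp: indicator_def)
    qed
    finally show ?thesis .
  qed
  have "emeasure lborel S = emeasure lborel ({t. t \<in> S \<and> g t \<le> \<theta>} \<union> {t. t \<in> S \<and> \<not> g t \<le> \<theta>})"
    by (rule arg_cong[where f = "emeasure lborel"]) auto
  also have "\<dots> = ennreal (c * \<theta>) * ?w + ennreal (c * (1 - \<theta>)) * ?w"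
    by (subst plus_emeasure[symmetric]) (auto simp: left[simplified] right[simplified])
  also have "\<dots> = ennreal c * ?w"
    using c \<theta> by (simp flip: distrib_right ennreal_plus) (simp add: algebra_simps)
  finally have "ennreal \<theta> * emeasure lborel S = emeasure lborel {t. t \<in> S \<and> g t \<le> \<theta>}"
    using c \<theta> left by (simp add: ennreal_mult' mult_ac)
  moreover have "S \<subseteq> {0..1}" using lo by (auto simp: S_def)
  ultimately show ?thesis
    by (subst (1 2) emeasure_unif) auto
qed

text \<open>The sets \<open>{j. L j \<le> c}\<close> and their images under \<open>\<rho>\<close> are up-sets for \<open>y\<close> of equal size,
  hence equal.\<close>

lemma permutes_preserves_level:
  fixes L :: "'a \<Rightarrow> nat" and y :: "'a \<Rightarrow> real"
  assumes fin: "finite I" and \<rho>: "\<rho> permutes I"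
    and y: "\<And>j j'. j \<in> I \<Longrightarrow> j' \<in> I \<Longrightarrow> L j < L j' \<Longrightarrow> y j' < y j"
    and y\<rho>: "\<And>j j'. j \<in> I \<Longrightarrow> j' \<in> I \<Longrightarrow> L j < L j' \<Longrightarrow> y (\<rho> j') < y (\<rho> j)"
    and j: "j \<in> I"
  shows "L (\<rho> j) = L j"
proof -
  define H where "H c = {j \<in> I. L j \<le> c}" for c
  have H: "\<rho> ` H c = H c" for c
  proof -
    have fH: "finite (H c)" using fin by (simp add: H_def)
    have card: "card (\<rho> ` H c) = card (H c)" by (rule card_image[OF permutes_inj_on[OF \<rho>]])
    have sub: "\<rho> ` H c \<subseteq> I" using permutes_in_image[OF \<rho>] by (auto simp: H_def)
    \<comment> \<open>If both inclusions failed, the witnesses \<open>\<rho> a\<close> and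
      \<open>b\<close> would be ordered one way by \<open>y\<rho>\<close> and the opposite way by
      \<open>y\<close>.\<close>
    have "\<rho> ` H c \<subseteq> H c \<or> H c \<subseteq> \<rho> ` H c"
    proof (rule ccontr)
      assume "\<not> ?thesis"
      then obtain a b where a: "a \<in> H c" "\<rho> a \<notin> H c" and b: "b \<in> H c" "b \<notin> \<rho> ` H c" by blast
      have "b \<in> \<rho> ` I" using b(1) permutes_image[OF \<rho>] by (simp add: H_def)
      then obtain b' where b': "b' \<in> I" "b = \<rho> b'" by blast
      have "b' \<notin> H c" using b b' by blast
      then have "L a < L b'" using a b' by (simp add: H_def)
      then have "y b < y (\<rho> a)" using y\<rho>[of a b'] a b' by (simp add: H_def)
      moreover have "\<rho> a \<in> I" using sub a by blast
      then have "L b < L (\<rho> a)" using a(2) b(1) by (simp add: H_def)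
      then have "y (\<rho> a) < y b" using y[of b "\<rho> a"] b \<open>\<rho> a \<in> I\<close> by (simp add: H_def)
      ultimately show False by simp
    qed
    then show ?thesis
      using card fH by (metis card_subset_eq finite_imageI)
  qed
  have "\<rho> j \<in> H (L j)" using H[of "L j"] j by (auto simp: H_def)
  then have le: "L (\<rho> j) \<le> L j" by (simp add: H_def)
  \<comment> \<open>The reverse inequality uses the set at the level of \<open>\<rho> j\<close>,
    where injectivity pulls membership back to \<open>j\<close>.\<close>
  have "\<rho> j \<in> I" using permutes_in_image[OF \<rho>] j by simp
  then have "\<rho> j \<in> \<rho> ` H (L (\<rho> j))" using H[of "L (\<rho> j)"] by (simp add: H_def)
  then have "j \<in> H (L (\<rho> j))" using permutes_inj[OF \<rho>] by (simp add: inj_image_mem_iff)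
  then show ?thesis using le by (simp add: H_def)
qed

text \<open>A least moved point \<open>j\<close> is impossible. Moving it down contradicts
  strictness at the smaller fixed point \<open>\<rho> j\<close>; moving it up leaves
  \<open>j\<close> without a preimage, since smaller points are fixed and larger ones map above
  \<open>\<rho> j\<close>.\<close>

lemma strict_mono_on_onto_self:
  fixes \<rho> :: "nat \<Rightarrow> nat"
  assumes mono: "strict_mono_on S \<rho>" and onto: "\<rho> ` S = S" and "j \<in> S"
  shows "\<rho> j = j"
  using \<open>j \<in> S\<close>
proof (induction j rule: less_induct)
  case (less j)
  have jS: "\<rho> j \<in> S" using onto less.prems by blast
  obtain k where k: "k \<in> S" "j = \<rho> k" using onto less.prems by blast
  show ?case
  proof (cases "\<rho> j" j rule: linorder_cases)
    case less': less
    then have "\<rho> (\<rho> j) = \<rho> j" using less.IH jS by blast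
    moreover have "\<rho> (\<rho> j) < \<rho> j" using strict_mono_onD[OF mono jS less.prems less'] .
    ultimately show ?thesis by simp
  next
    case greater
    show ?thesis
    proof (cases "k < j")
      case True
      then show ?thesis using less.IH[OF True k(1)] k by simp
    next
      case False
      then have "j < k \<or> j = k" by auto
      then have "\<rho> j \<le> \<rho> k"
        using strict_mono_onD[OF mono less.prems k(1)] by auto
      then show ?thesis using greater k by simp
    qed
  qed simp
qed

section \<open>Admissible vectors: cells, uniqueness of the reordering, initial ranks\<close>

locale switching =
  fixes n d :: nat and p m :: "nat \<Rightarrow> nat" and B :: "nat \<Rightarrow> nat set" and \<theta> :: "nat \<Rightarrow> real"
  assumes fixed: "fixed_positions n d p"
    and scheme: "switching_scheme n d p m B"
    and jumps: "jump_probabilities d p \<theta>"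
begin

abbreviation blocks :: "nat set" where "blocks \<equiv> (\<Union>i\<in>{1..d + 1}. B i)"

text \<open>The junction points \<open>1 = b\<^sub>0 > b\<^sub>1 > ... > b\<^sub>d\<^sub>+\<^sub>1 = 0\<close> of the intervals, read off
  from the rearranged vector itself.\<close>

definition bound :: "(nat \<Rightarrow> real) \<Rightarrow> nat \<Rightarrow> real" where
  "bound y i = (if i = 0 then 1 else if i \<le> d then y (m i) else 0)"

definition blk :: "nat \<Rightarrow> nat" where
  "blk j = (THE i. i \<in> {1..d + 1} \<and> j \<in> B i)"

text \<open>The cell of a position, numbered from the largest values downwards: odd for a block, even for a
  fixed position.\<close>

definition level :: "nat \<Rightarrow> nat" where
  "level j = (if j \<in> blocks then 2 * blk j - 1 else 2 * inv_into {1..d} m j)"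

abbreviation jump :: "(nat \<Rightarrow> real) \<Rightarrow> nat \<Rightarrow> real \<Rightarrow> real" where
  "jump y i t \<equiv> jump_fun (\<theta> i) (affine_unit (bound y i) (bound y (i - 1)) t)"

text \<open>Stated in the values of \<open>y\<close> alone, so that it makes sense for every vector
  of the cube. The order of the junction points is a separate condition because an empty block puts
  no value between its two ends.\<close>

definition admissible :: "(nat \<Rightarrow> real) \<Rightarrow> bool" where
  "admissible y \<longleftrightarrow>
     (\<forall>i\<in>{1..d + 1}. bound y i < bound y (i - 1)) \<and>
     (\<forall>i\<in>{1..d + 1}. \<forall>j\<in>B i. bound y i < y j \<and> y j < bound y (i - 1)) \<and>
     (\<forall>i\<in>{1..d + 1}. \<forall>j\<in>B i. \<forall>j'\<in>B i. j < j' \<longrightarrow> jump y i (y j) < jump y i (y j'))"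

text \<open>Whether \<open>y j\<close> lies left of the jump point of its block; for \<open>j\<close> in a block only
  (otherwise \<open>blk j\<close> is junk).\<close>

definition left :: "(nat \<Rightarrow> real) \<Rightarrow> nat \<Rightarrow> bool" where
  "left y j \<longleftrightarrow> affine_unit (bound y (blk j)) (bound y (blk j - 1)) (y j) \<le> \<theta> (blk j)"

lemma m_inj: "inj_on m {1..d}" and m_in: "i \<in> {1..d} \<Longrightarrow> m i \<in> {1..n}"
  and blocks_eq: "blocks = {1..n} - m ` {1..d}"
  and card_B: "i \<in> {1..d + 1} \<Longrightarrow> card (B i) = card (blockN p i)"
  using scheme unfolding switching_scheme_def by blast+

lemma B_disjoint: "i \<in> {1..d + 1} \<Longrightarrow> i' \<in> {1..d + 1} \<Longrightarrow> j \<in> B i \<Longrightarrow> j \<in> B i' \<Longrightarrow> i = i'"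
  using scheme unfolding switching_scheme_def disjoint_family_on_def by blast

lemma B_in: "i \<in> {1..d + 1} \<Longrightarrow> j \<in> B i \<Longrightarrow> j \<in> {1..n}"
  using blocks_eq by blast

lemma B_not_m: "i \<in> {1..d + 1} \<Longrightarrow> j \<in> B i \<Longrightarrow> i' \<in> {1..d} \<Longrightarrow> m i' \<noteq> j"
  using blocks_eq by blast

lemma \<theta>_bounds:
  assumes "i \<in> {1..d + 1}" "j \<in> B i"
  shows "0 < \<theta> i" "\<theta> i < 1"
proof -
  have "finite (B i)" using B_in[OF assms(1)] by (meson finite_atLeastAtMost finite_subset subsetI)
  then have "card (B i) \<noteq> 0" using assms by auto
  then have "blockN p i \<noteq> {}" using card_B[OF assms(1)] by auto
  then show "0 < \<theta> i" "\<theta> i < 1" using jumps assms(1) by (auto simp: jump_probabilities_def)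
qed

lemma blk_eq:
  assumes "i \<in> {1..d + 1}" "j \<in> B i"
  shows "blk j = i"
  unfolding blk_def using assms B_disjoint by (intro the_equality) blast+

lemma level_B: "i \<in> {1..d + 1} \<Longrightarrow> j \<in> B i \<Longrightarrow> level j = 2 * i - 1"
  using blk_eq by (auto simp: level_def)

lemma level_m:
  assumes "i \<in> {1..d}"
  shows "level (m i) = 2 * i"
proof -
  have "m i \<notin> blocks" using blocks_eq assms by blast
  then show ?thesis using inv_into_f_f[OF m_inj assms] by (simp add: level_def)
qed

lemma position_cases:
  assumes "j \<in> {1..n}"
  obtains (fixed) i where "i \<in> {1..d}" "j = m i" "level j = 2 * i"
  | (block) i where "i \<in> {1..d + 1}" "j \<in> B i" "level j = 2 * i - 1"
proof (cases "j \<in> blocks")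
  case True
  then show ?thesis using level_B block by blast
next
  case False
  then have "j \<in> m ` {1..d}" using assms blocks_eq by blast
  then show ?thesis using level_m fixed by blast
qed

lemma bound_m: "i \<in> {1..d} \<Longrightarrow> bound y i = y (m i)"
  by (simp add: bound_def)

lemma bound_antimono:
  assumes step: "\<forall>i\<in>{1..d + 1}. bound y i < bound y (i - 1)" and "i \<le> i'" "i' \<le> d + 1"
  shows "bound y i' \<le> bound y i"
  using \<open>i \<le> i'\<close> \<open>i' \<le> d + 1\<close>
proof (induction i' rule: dec_induct)
  case (step k)
  then have "bound y (Suc k) < bound y k" using bspec[OF assms(1), of "Suc k"] by simp
  then show ?case using step by simp
qed simp

lemma bound_strict_antimono:
  assumes step: "\<forall>i\<in>{1..d + 1}. bound y i < bound y (i - 1)" and "i < i'" "i' \<le> d + 1"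
  shows "bound y i' < bound y i"
proof -
  have "bound y i' < bound y (i' - 1)" using bspec[OF step, of i'] assms(2,3) by simp
  also have "\<dots> \<le> bound y i" using assms(2,3) by (intro bound_antimono[OF step]) auto
  finally show ?thesis .
qed

lemma bound_range:
  assumes step: "\<forall>i\<in>{1..d + 1}. bound y i < bound y (i - 1)" and "i \<le> d + 1"
  shows "0 \<le> bound y i" "bound y i \<le> 1"
  using bound_antimono[OF step, of i "d + 1"] bound_antimono[OF step, of 0 i] assms(2)
  by (auto simp: bound_def)

lemma admissibleD:
  assumes "admissible y"
  shows "\<forall>i\<in>{1..d + 1}. bound y i < bound y (i - 1)"
    and "i \<in> {1..d + 1} \<Longrightarrow> j \<in> B i \<Longrightarrow> bound y i < y j"
    and "i \<in> {1..d + 1} \<Longrightarrow> j \<in> B i \<Longrightarrow> y j < bound y (i - 1)"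
    and "i \<in> {1..d + 1} \<Longrightarrow> j \<in> B i \<Longrightarrow> j' \<in> B i \<Longrightarrow> j < j' \<Longrightarrow> jump y i (y j) < jump y i (y j')"
  using assms unfolding admissible_def by blast+

text \<open>Cells of different level are separated by a junction value. Block \<open>i\<close> has
  level \<open>2 * i - 1\<close>, between the junctions at \<open>2 * (i - 1)\<close> and
  \<open>2 * i\<close>, so comparing levels amounts to comparing indices of junctions.\<close>

lemma admissible_level:
  assumes y: "admissible y" and j: "j \<in> {1..n}" "j' \<in> {1..n}" "level j < level j'"
  shows "y j' < y j"
proof -
  note anti = bound_antimono[OF admissibleD(1)[OF y]]
  note santi = bound_strict_antimono[OF admissibleD(1)[OF y]]
  from j(1) show ?thesis
  proof (cases rule: position_cases)
    case i: (fixed i)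
    from j(2) show ?thesis
    proof (cases rule: position_cases)
      case i': (fixed i')
      then show ?thesis using santi[of i i'] bound_m[of i y] bound_m[of i' y] i j(3) by simp
    next
      case i': (block i')
      then have "bound y (i' - 1) \<le> bound y i" using i j(3) by (intro anti) auto
      then show ?thesis using admissibleD(3)[OF y i'(1,2)] bound_m[of i y] i by simp
    qed
  next
    case i: (block i)
    from j(2) show ?thesis
    proof (cases rule: position_cases)
      case i': (fixed i')
      then have "bound y i' \<le> bound y i" using i j(3) by (intro anti) auto
      then show ?thesis using admissibleD(2)[OF y i(1,2)] bound_m[of i' y] i' by simp
    next
      case i': (block i')
      then have "bound y (i' - 1) \<le> bound y i" using i j(3) by (intro anti) auto
      then show ?thesis using admissibleD(3)[OF y i'(1,2)] admissibleD(2)[OF y i(1,2)] by simp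
    qed
  qed
qed

text \<open>Parity tells blocks from fixed positions, and every fixed position has an even level to
  itself.\<close>

lemma same_level:
  assumes j: "j \<in> {1..n}" "j' \<in> {1..n}" "level j = level j'"
  shows "j = j' \<or> (\<exists>i\<in>{1..d + 1}. j \<in> B i \<and> j' \<in> B i)"
proof -
  from j(1) show ?thesis
  proof (cases rule: position_cases)
    case i: (fixed i)
    from j(2) show ?thesis
    proof (cases rule: position_cases)
      case i': (fixed i')
      then show ?thesis using i j(3) by simp
    next
      case i': (block i')
      then have "2 * i = 2 * i' - 1" using i j(3) by simp
      moreover have "i' \<ge> 1" using i' by simp
      ultimately show ?thesis by presburger
    qed
  next
    case i: (block i)
    from j(2) show ?thesis
    proof (cases rule: position_cases)
      case i': (fixed i')
      then have "2 * i' = 2 * i - 1" using i j(3) by simp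
      moreover have "i \<ge> 1" using i by simp
      ultimately show ?thesis by presburger
    next
      case i': (block i')
      then have "2 * i' - 1 = 2 * i - 1" using i j(3) by simp
      moreover have "i \<ge> 1" "i' \<ge> 1" using i i' by simp_all
      ultimately have "i = i'" by presburger
      then show ?thesis using i i' by blast
    qed
  qed
qed

text \<open>Both vectors order the cells alike, so \<open>\<rho>\<close> preserves levels. It
  therefore fixes every \<open>m i\<close>, which makes the junction points and jump functions of
  the two vectors coincide. Inside a block the common jump order then makes \<open>\<rho>\<close>
  increasing, hence trivial.\<close>

lemma admissible_perm_unique:
  assumes y: "admissible y" and y\<rho>: "admissible (\<lambda>j. y (\<rho> j))" and \<rho>: "\<rho> permutes {1..n}"
  shows "\<rho> = id"
proof -
  have level: "level (\<rho> j) = level j" if "j \<in> {1..n}" for j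
    using admissible_level[OF y] admissible_level[OF y\<rho>] that
    by (intro permutes_preserves_level[of "{1..n}" \<rho> level y j] \<rho>) auto
  have in_n: "\<rho> j \<in> {1..n}" if "j \<in> {1..n}" for j using permutes_in_image[OF \<rho>] that by blast
  have B: "\<rho> j \<in> B i" if i: "i \<in> {1..d + 1}" "j \<in> B i" for i j
    using same_level[OF _ _ level, of j] in_n B_in[OF i] i B_disjoint by metis
  have fixed: "\<rho> (m i) = m i" if i: "i \<in> {1..d}" for i
    using same_level[OF in_n _ level, of "m i"] m_in[OF i] B_not_m i by blast
  have bound: "bound (\<lambda>j. y (\<rho> j)) i = bound y i" for i
    using fixed[of i] by (simp add: bound_def)
  have fixB: "\<rho> j = j" if i: "i \<in> {1..d + 1}" "j \<in> B i" for i j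
  proof (rule strict_mono_on_onto_self)
    show "strict_mono_on (B i) \<rho>"
    proof (rule strict_mono_onI)
      fix r s assume rs: "r \<in> B i" "s \<in> B i" "r < s"
      have "jump y i (y (\<rho> r)) < jump y i (y (\<rho> s))"
        using admissibleD(4)[OF y\<rho> i(1) rs] by (simp add: bound)
      then show "\<rho> r < \<rho> s"
        using admissibleD(4)[OF y i(1) B[OF i(1) rs(2)] B[OF i(1) rs(1)]]
        by (metis linorder_neqE_nat order_less_asym)
    qed
    have "finite (B i)" using B_in[OF i(1)] by (meson finite_atLeastAtMost finite_subset subsetI)
    then show "\<rho> ` B i = B i" using B[OF i(1)] permutes_inj_on[OF \<rho>] by (intro endo_inj_surj) auto
  qed fact
  have "\<rho> j = j" if "j \<in> {1..n}" for j
    using that by (rule position_cases) (use fixed fixB in blast)+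
  then show ?thesis
    using permutes_not_in[OF \<rho>] by (auto simp: fun_eq_iff)
qed

text \<open>Jump values increase with the position, and each branch is monotone. If
  \<open>y j\<close> is on the left, a point at or below it has at least its jump value, so all
  earlier values of the block lie above; if it is on the right, no earlier one can lie above. The
  \<open>\<le>\<close> in \<open>left\<close> follows the case split of \<open>jump_fun\<close>, so
  this holds for every admissible vector and not just almost surely.\<close>

lemma admissible_rank:
  assumes y: "admissible y" and j: "j \<in> {1..n}"
  shows "initial_rank y j = 1 + card {i \<in> {1..<j}. level i < level j} +
    (if j \<in> blocks \<and> left y j then card {i \<in> {1..<j}. level i = level j} else 0)"
proof -
  let ?b = "j \<in> blocks \<and> left y j"
  have iff: "y j < y i \<longleftrightarrow> level i < level j \<or> (?b \<and> level i = level j)" if i: "i \<in> {1..<j}" for i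
  proof -
    have i': "i \<in> {1..n}" using i j by auto
    show ?thesis
    proof (cases "level i" "level j" rule: linorder_cases)
      case less
      then show ?thesis using admissible_level[OF y i' j] by simp
    next
      case greater
      then show ?thesis using admissible_level[OF y j i'] by simp
    next
      case equal
      then obtain k where k: "k \<in> {1..d + 1}" "i \<in> B k" "j \<in> B k"
        using same_level[OF i' j] i by auto
      have blk: "blk j = k" using blk_eq k by blast
      define g where "g = affine_unit (bound y k) (bound y (k - 1))"
      have \<theta>: "0 < \<theta> k" "\<theta> k < 1" using \<theta>_bounds k by blast+
      have pos: "bound y k < bound y (k - 1)" using admissibleD(1)[OF y] k by blast
      have mono: "g s \<le> g t \<longleftrightarrow> s \<le> t" for s t
        unfolding g_def affine_unit_def using pos by (simp add: divide_le_cancel)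
      have jump: "jump_fun (\<theta> k) (g (y i)) < jump_fun (\<theta> k) (g (y j))"
        using admissibleD(4)[OF y k] i by (simp add: g_def)
      have "y j < y i \<longleftrightarrow> g (y j) \<le> \<theta> k"
      proof
        assume l: "g (y j) \<le> \<theta> k"
        show "y j < y i"
        proof (rule ccontr)
          assume "\<not> y j < y i"
          then have "g (y i) \<le> g (y j)" using mono by simp
          then have "jump_fun (\<theta> k) (g (y j)) \<le> jump_fun (\<theta> k) (g (y i))"
            using l \<theta> by (simp add: jump_fun_def divide_right_mono)
          then show False using jump by simp
        qed
      next
        assume less: "y j < y i"
        show "g (y j) \<le> \<theta> k"
        proof (rule ccontr)
          assume r: "\<not> g (y j) \<le> \<theta> k"
          have "g (y j) \<le> g (y i)" using mono less by simp
          then have "jump_fun (\<theta> k) (g (y j)) \<le> jump_fun (\<theta> k) (g (y i))"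
            using r \<theta> by (simp add: jump_fun_def divide_right_mono)
          then show False using jump by simp
        qed
      qed
      then show ?thesis using equal k blk by (auto simp: left_def g_def)
    qed
  qed
  have "{i \<in> {1..<j}. y i > y j} =
      {i \<in> {1..<j}. level i < level j} \<union> (if ?b then {i \<in> {1..<j}. level i = level j} else {})"
    using iff by auto
  moreover have "card \<dots> = card {i \<in> {1..<j}. level i < level j} +
      card (if ?b then {i \<in> {1..<j}. level i = level j} else {})"
    by (rule card_Un_disjoint) auto
  ultimately show ?thesis by (simp add: initial_rank_def)
qed

lemma bound_cong:
  assumes "\<And>j. j \<in> {1..n} \<Longrightarrow> y j = z j"
  shows "bound y i = bound z i"
  using assms m_in[of i] by (simp add: bound_def)

lemma admissible_cong:
  assumes eq: "\<And>j. j \<in> {1..n} \<Longrightarrow> y j = z j"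
  shows "admissible y = admissible z"
proof -
  have 1: "bound y i = bound z i" for i using bound_cong[OF eq] .
  have 2: "y j = z j" if "i \<in> {1..d + 1}" "j \<in> B i" for i j using eq B_in[OF that] .
  show ?thesis unfolding admissible_def 1
    by (intro arg_cong2[where f = "(\<and>)"] ball_cong refl) (simp_all only: 2)
qed

end

section \<open>Measurability, and the law of the left/right choices under the product
  measure\<close>

context switching begin

abbreviation V :: "(nat \<Rightarrow> real) measure" where "V \<equiv> Pi\<^sub>M {1..n} (\<lambda>_. borel)"
abbreviation N :: "(nat \<Rightarrow> real) measure" where "N \<equiv> Pi\<^sub>M {1..n} (\<lambda>_. unif)"

lemma sets_N: "sets N = sets V"
  by (intro sets_PiM_cong) auto

lemma space_N: "space N = space V"
  using sets_N by (rule sets_eq_imp_space_eq)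

lemma finite_B: "i \<in> {1..d + 1} \<Longrightarrow> finite (B i)"
  using B_in by (meson finite_atLeastAtMost finite_subset subsetI)

lemma measurable_component_V: "j \<in> {1..n} \<Longrightarrow> (\<lambda>y. y j) \<in> borel_measurable V"
  by measurable

lemma measurable_bound: "(\<lambda>y. bound y i) \<in> borel_measurable V"
proof (cases "i \<in> {1..d}")
  case True
  then show ?thesis using measurable_component_V[OF m_in[OF True]] by (simp add: bound_def)
next
  case False
  then have "(\<lambda>y. bound y i) = (\<lambda>_. if i = 0 then 1 else 0)"
    by (intro ext) (simp add: bound_def)
  then show ?thesis by simp
qed

lemma measurable_affine_unit:
  assumes "f \<in> borel_measurable V"
  shows "(\<lambda>y. affine_unit (bound y i) (bound y i') (f y)) \<in> borel_measurable V"
  unfolding affine_unit_def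
  by (intro borel_measurable_divide borel_measurable_diff measurable_bound assms)

lemma measurable_jump:
  assumes "f \<in> borel_measurable V"
  shows "(\<lambda>y. jump y i (f y)) \<in> borel_measurable V"
proof -
  have "jump_fun (\<theta> i) \<in> borel_measurable borel"
    unfolding jump_fun_def[abs_def] by measurable
  from measurable_compose[OF measurable_affine_unit[OF assms] this] show ?thesis .
qed

lemma pred_admissible: "Measurable.pred V admissible"
  unfolding admissible_def[abs_def]
proof (intro pred_intros_logic pred_intros_finite finite_atLeastAtMost)
  fix i j assume i: "i \<in> {1..d + 1}"
  show "finite (B i)" "finite (B i)" "finite (B i)" using finite_B i by auto
  show "Measurable.pred V (\<lambda>y. bound y i < bound y (i - 1))"
    unfolding pred_def by (intro borel_measurable_less measurable_bound)
  assume j: "j \<in> B i"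
  note y = measurable_component_V[OF B_in[OF i]]
  show "Measurable.pred V (\<lambda>y. bound y i < y j)" "Measurable.pred V (\<lambda>y. y j < bound y (i - 1))"
    unfolding pred_def by (intro borel_measurable_less measurable_bound y j)+
  fix j' assume "j' \<in> B i"
  then show "Measurable.pred V (\<lambda>y. jump y i (y j) < jump y i (y j'))"
    unfolding pred_def by (intro borel_measurable_less measurable_jump y j)
qed auto

lemma pred_left:
  assumes "j \<in> {1..n}"
  shows "Measurable.pred V (\<lambda>y. left y j)"
  unfolding left_def pred_def
  by (intro borel_measurable_le measurable_affine_unit measurable_component_V assms borel_measurable_const)

lemma pred_left_pattern:
  assumes K: "K \<subseteq> {1..n}"
  shows "Measurable.pred V (\<lambda>y. \<forall>j\<in>K. left y j = s j)"
proof (rule pred_intros_finite)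
  show "finite K" using K by (rule finite_subset) simp
  fix j assume "j \<in> K"
  then have "j \<in> {1..n}" using K by blast
  from pred_left[OF this] show "Measurable.pred V (\<lambda>y. left y j = s j)"
    by (cases "s j") (simp_all add: pred_intros_logic)
qed

text \<open>Block positions are never junction points, so moving a block coordinate keeps all
  intervals and jump functions.\<close>

lemma bound_upd:
  assumes "j \<in> blocks"
  shows "bound (y(j := t)) i = bound y i"
proof -
  have "m i \<noteq> j" if "i \<in> {1..d}" using assms B_not_m that by blast
  then show ?thesis by (simp add: bound_def)
qed

lemma left_upd: "j \<in> blocks \<Longrightarrow> j' \<noteq> j \<Longrightarrow> left (y(j := t)) j' = left y j'"
  by (simp add: left_def bound_upd)

text \<open>Separates the requirements on the other coordinates from those on \<open>t\<close>;
  neither part reads \<open>x j\<close>. The order within the block constrains \<open>t\<close> only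
  through its jump value, which must lie between those of the earlier and of the later
  positions.\<close>

lemma admissible_upd_iff:
  assumes i: "i \<in> {1..d + 1}" "j \<in> B i"
  defines "W x \<equiv> {u. (\<forall>k\<in>B i. k < j \<longrightarrow> jump x i (x k) < u) \<and> (\<forall>k\<in>B i. j < k \<longrightarrow> u < jump x i (x k))}"
  shows "admissible (x(j := t)) \<longleftrightarrow>
     ((\<forall>i\<in>{1..d + 1}. bound x i < bound x (i - 1)) \<and>
      (\<forall>i\<in>{1..d + 1}. \<forall>k\<in>B i. k \<noteq> j \<longrightarrow> bound x i < x k \<and> x k < bound x (i - 1)) \<and>
      (\<forall>i\<in>{1..d + 1}. \<forall>k\<in>B i. \<forall>k'\<in>B i. k \<noteq> j \<longrightarrow> k' \<noteq> j \<longrightarrow> k < k' \<longrightarrow> jump x i (x k) < jump x i (x k'))) \<and>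
     (bound x i < t \<and> t < bound x (i - 1) \<and> jump x i t \<in> W x)"
proof -
  have j: "j \<in> blocks" using i by blast
  have 2: "(\<forall>i\<in>{1..d + 1}. \<forall>k\<in>B i. bound x i < (x(j := t)) k \<and> (x(j := t)) k < bound x (i - 1)) \<longleftrightarrow>
     (\<forall>i\<in>{1..d + 1}. \<forall>k\<in>B i. k \<noteq> j \<longrightarrow> bound x i < x k \<and> x k < bound x (i - 1)) \<and>
     bound x i < t \<and> t < bound x (i - 1)" (is "?l \<longleftrightarrow> ?r")
  proof
    assume ?l
    then show ?r using i by (metis fun_upd_apply)
  next
    assume r: ?r
    show ?l
    proof (intro ballI)
      fix i' k assume i': "i' \<in> {1..d + 1}" "k \<in> B i'"
      show "bound x i' < (x(j := t)) k \<and> (x(j := t)) k < bound x (i' - 1)"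
      proof (cases "k = j")
        case True
        then have "i' = i" using B_disjoint i i' by blast
        then show ?thesis using r True by simp
      next
        case False
        then show ?thesis using r i' by simp
      qed
    qed
  qed
  have 3: "(\<forall>i\<in>{1..d + 1}. \<forall>k\<in>B i. \<forall>k'\<in>B i. k < k' \<longrightarrow> jump x i ((x(j := t)) k) < jump x i ((x(j := t)) k')) \<longleftrightarrow>
     (\<forall>i\<in>{1..d + 1}. \<forall>k\<in>B i. \<forall>k'\<in>B i. k \<noteq> j \<longrightarrow> k' \<noteq> j \<longrightarrow> k < k' \<longrightarrow> jump x i (x k) < jump x i (x k')) \<and>
     jump x i t \<in> W x" (is "?l \<longleftrightarrow> ?r1 \<and> ?r2")
  proof
    assume l: ?l
    have ?r1
    proof (intro ballI impI)
      fix i' k k' assume "i' \<in> {1..d + 1}" "k \<in> B i'" "k' \<in> B i'" "k \<noteq> j" "k' \<noteq> j" "k < k'"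
      then show "jump x i' (x k) < jump x i' (x k')"
        using l[rule_format, of i' k k'] by simp
    qed
    moreover have "jump x i (x k) < jump x i t" if "k \<in> B i" "k < j" for k
      using l[rule_format, of i k j] that i by simp
    moreover have "jump x i t < jump x i (x k)" if "k \<in> B i" "j < k" for k
      using l[rule_format, of i j k] that i by simp
    ultimately show "?r1 \<and> ?r2" unfolding W_def by blast
  next
    assume r: "?r1 \<and> ?r2"
    show ?l
    proof (intro ballI impI)
      fix i' k k' assume i': "i' \<in> {1..d + 1}" "k \<in> B i'" "k' \<in> B i'" "k < k'"
      show "jump x i' ((x(j := t)) k) < jump x i' ((x(j := t)) k')"
      proof (cases "k = j \<or> k' = j")
        case True
        then have "i' = i" using B_disjoint i i' by blast
        then show ?thesis using r True i' by (auto simp: W_def)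
      next
        case False
        then show ?thesis using r i' by simp
      qed
    qed
  qed
  show ?thesis
    unfolding admissible_def bound_upd[OF j] 2 3 by blast
qed

text \<open>With all other coordinates fixed, admissibility restricts coordinate \<open>j\<close> to the preimage of a
  window under the jump function of its block.\<close>

lemma emeasure_left:
  assumes i: "i \<in> {1..d + 1}" "j \<in> B i" and Q: "Measurable.pred V Q" "\<And>y t. Q (y(j := t)) = Q y"
  shows "emeasure N {y \<in> space N. (admissible y \<and> Q y) \<and> left y j} =
    ennreal (\<theta> i) * emeasure N {y \<in> space N. admissible y \<and> Q y}"
proof -
  interpret prob_space unif by (rule prob_space_unif)
  interpret product_sigma_finite "\<lambda>_. unif" by standard
  have jn: "j \<in> {1..n}" using B_in[OF i] .
  have jb: "j \<in> blocks" using i by blast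
  note \<theta> = \<theta>_bounds[OF i]
  have P1: "Measurable.pred V (\<lambda>y. (admissible y \<and> Q y) \<and> left y j)"
    and P2: "Measurable.pred V (\<lambda>y. admissible y \<and> Q y)"
    using pred_admissible pred_left[OF jn] Q(1) by (auto intro: pred_intros_logic)
  note P1 = P1[unfolded measurable_cong_sets[OF sets_N[symmetric] refl]]
    and P2 = P2[unfolded measurable_cong_sets[OF sets_N[symmetric] refl]]
  \<comment> \<open>This holds for every \<open>x\<close>: if \<open>C\<close> or \<open>Q x\<close>
    fails, both slices are empty; otherwise the ordered junction points keep the interval of the
    window inside the unit interval.\<close>
  have slice: "emeasure unif {t \<in> space unif. (admissible (x(j := t)) \<and> Q (x(j := t))) \<and> left (x(j := t)) j} =
      ennreal (\<theta> i) * emeasure unif {t \<in> space unif. admissible (x(j := t)) \<and> Q (x(j := t))}" for x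
  proof -
    define C where "C \<longleftrightarrow> (\<forall>i\<in>{1..d + 1}. bound x i < bound x (i - 1)) \<and>
      (\<forall>i\<in>{1..d + 1}. \<forall>k\<in>B i. k \<noteq> j \<longrightarrow> bound x i < x k \<and> x k < bound x (i - 1)) \<and>
      (\<forall>i\<in>{1..d + 1}. \<forall>k\<in>B i. \<forall>k'\<in>B i. k \<noteq> j \<longrightarrow> k' \<noteq> j \<longrightarrow> k < k' \<longrightarrow> jump x i (x k) < jump x i (x k'))"
    define W where "W = {u. (\<forall>k\<in>B i. k < j \<longrightarrow> jump x i (x k) < u) \<and> (\<forall>k\<in>B i. j < k \<longrightarrow> u < jump x i (x k))}"
    define S where "S = {t. bound x i < t \<and> t < bound x (i - 1) \<and> jump x i t \<in> W}"
    have adm: "admissible (x(j := t)) \<longleftrightarrow> C \<and> t \<in> S" for t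
      unfolding admissible_upd_iff[OF i] C_def S_def W_def by simp
    have left: "left (x(j := t)) j \<longleftrightarrow> affine_unit (bound x i) (bound x (i - 1)) t \<le> \<theta> i" for t
      by (simp add: left_def bound_upd[OF jb] blk_eq[OF i])
    show ?thesis
    proof (cases "C \<and> Q x")
      case True
      then have step: "\<forall>i\<in>{1..d + 1}. bound x i < bound x (i - 1)" by (simp add: C_def)
      have "Measurable.pred borel (\<lambda>u. (\<forall>k\<in>B i. k < j \<longrightarrow> jump x i (x k) < u) \<and> (\<forall>k\<in>B i. j < k \<longrightarrow> u < jump x i (x k)))"
        using finite_B[OF i(1)] by (intro pred_intros_logic pred_intros_finite) measurable
      then have W: "W \<in> sets borel" unfolding W_def pred_def by simp
      have "emeasure unif {t. t \<in> S \<and> affine_unit (bound x i) (bound x (i - 1)) t \<le> \<theta> i} = ennreal (\<theta> i) * emeasure unif S"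
        unfolding S_def using bound_range[OF step, of i] bound_range[OF step, of "i - 1"] bspec[OF step i(1)] i(1)
        by (intro emeasure_jump_window \<theta> W) auto
      moreover have "{t \<in> space unif. (admissible (x(j := t)) \<and> Q (x(j := t))) \<and> left (x(j := t)) j} =
          {t. t \<in> S \<and> affine_unit (bound x i) (bound x (i - 1)) t \<le> \<theta> i}"
        "{t \<in> space unif. admissible (x(j := t)) \<and> Q (x(j := t))} = S"
        using True by (auto simp: adm left Q(2))
      ultimately show ?thesis by (simp only:)
    next
      case False
      then have "{t \<in> space unif. (admissible (x(j := t)) \<and> Q (x(j := t))) \<and> left (x(j := t)) j} = {}"
        "{t \<in> space unif. admissible (x(j := t)) \<and> Q (x(j := t))} = {}"
        by (auto simp: adm Q(2))
      then show ?thesis by (simp only: emeasure_empty mult_zero_right)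
    qed
  qed
  have "emeasure N {y \<in> space N. (admissible y \<and> Q y) \<and> left y j} =
      (\<integral>\<^sup>+ x. ennreal (\<theta> i) * emeasure unif {t \<in> space unif. admissible (x(j := t)) \<and> Q (x(j := t))}
        \<partial>Pi\<^sub>M ({1..n} - {j}) (\<lambda>_. unif))"
    by (subst emeasure_PiM_slice[OF finite_atLeastAtMost jn P1]) (simp only: slice)
  also have "\<dots> = ennreal (\<theta> i) * (\<integral>\<^sup>+ x. emeasure unif {t \<in> space unif. admissible (x(j := t)) \<and> Q (x(j := t))}
        \<partial>Pi\<^sub>M ({1..n} - {j}) (\<lambda>_. unif))"
    by (intro nn_integral_cmult measurable_PiM_slice[OF finite_atLeastAtMost jn P2])
  also have "\<dots> = ennreal (\<theta> i) * emeasure N {y \<in> space N. admissible y \<and> Q y}"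
    by (simp only: emeasure_PiM_slice[OF finite_atLeastAtMost jn P2])
  finally show ?thesis .
qed

lemma prob_space_N: "prob_space N"
  by (intro prob_space_PiM prob_space_unif)

text \<open>Positions are peeled off one at a time. The sides of the others are absorbed into
  \<open>Q'\<close>, which ignores coordinate \<open>j\<close> because \<open>left\<close> at
  another position does not read it; the right side follows by subtraction.\<close>

lemma measure_left_pattern:
  fixes s :: "nat \<Rightarrow> bool"
  assumes "finite K" "K \<subseteq> blocks" and "Measurable.pred V Q" "\<And>y j t. j \<in> K \<Longrightarrow> Q (y(j := t)) = Q y"
  shows "measure N {y \<in> space N. admissible y \<and> Q y \<and> (\<forall>j\<in>K. left y j = s j)} =
    (\<Prod>j\<in>K. if s j then \<theta> (blk j) else 1 - \<theta> (blk j)) * measure N {y \<in> space N. admissible y \<and> Q y}"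
  using assms
proof (induction K rule: finite_induct)
  case (insert j K)
  interpret prob_space N by (rule prob_space_N)
  define Q' where "Q' y \<longleftrightarrow> Q y \<and> (\<forall>k\<in>K. left y k = s k)" for y
  obtain i where i: "i \<in> {1..d + 1}" "j \<in> B i" using insert.prems(1) by blast
  have jb: "j \<in> blocks" using i by blast
  have pred: "Measurable.pred V Q'"
  proof -
    have "K \<subseteq> {1..n}" using insert.prems(1) B_in by blast
    then show ?thesis
      using pred_left_pattern[of K s] insert.prems(2)
      unfolding Q'_def[abs_def] pred_def by (intro sets.sets_Collect_conj)
  qed
  have upd: "Q' (y(j := t)) = Q' y" for y t
  proof -
    have "left (y(j := t)) k = left y k" if "k \<in> K" for k
      using that insert.hyps(2) by (intro left_upd[OF jb]) auto
    moreover have "Q (y(j := t)) = Q y" using insert.prems(3) by blast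
    ultimately show ?thesis by (simp add: Q'_def)
  qed
  let ?A = "{y \<in> space N. admissible y \<and> Q' y}"
  let ?L = "{y \<in> space N. (admissible y \<and> Q' y) \<and> left y j}"
  have A: "?A \<in> events" and L: "?L \<in> events"
    using pred pred_admissible pred_left[OF B_in[OF i]]
    unfolding measurable_cong_sets[OF sets_N[symmetric] refl]
    by (auto simp: pred_def[symmetric] intro!: pred_intros_logic)
  have mL: "prob ?L = \<theta> i * prob ?A"
    unfolding measure_def emeasure_left[OF i pred upd]
    using \<theta>_bounds[OF i] by (simp add: enn2real_mult)
  have "{y \<in> space N. admissible y \<and> Q' y \<and> \<not> left y j} = ?A - ?L" by auto
  then have mR: "prob {y \<in> space N. admissible y \<and> Q' y \<and> \<not> left y j} = (1 - \<theta> i) * prob ?A"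
    using finite_measure_Diff[OF A L] mL by (auto simp: algebra_simps)
  have IH: "prob ?A = (\<Prod>j\<in>K. if s j then \<theta> (blk j) else 1 - \<theta> (blk j)) * prob {y \<in> space N. admissible y \<and> Q y}"
    unfolding Q'_def using insert.prems by (intro insert.IH) auto
  have "{y \<in> space N. admissible y \<and> Q y \<and> (\<forall>k\<in>insert j K. left y k = s k)} =
      (if s j then ?L else {y \<in> space N. admissible y \<and> Q' y \<and> \<not> left y j})"
    by (auto simp: Q'_def)
  then have "prob {y \<in> space N. admissible y \<and> Q y \<and> (\<forall>k\<in>insert j K. left y k = s k)} =
      (if s j then \<theta> i else 1 - \<theta> i) * prob ?A"
    using mL mR by simp
  also have "\<dots> = (\<Prod>k\<in>insert j K. if s k then \<theta> (blk k) else 1 - \<theta> (blk k)) *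
      prob {y \<in> space N. admissible y \<and> Q y}"
    unfolding IH prod.insert[OF insert.hyps] blk_eq[OF i] by (simp only: mult.assoc)
  finally show ?case .
qed simp

end

section \<open>An independence criterion for finitely many cases, and permuted i.i.d.
  families\<close>

lemma (in prob_space) indep_var_of_finite_cases:
  assumes R: "random_variable S R" and W: "random_variable T W"
    and Z: "Z \<in> measurable M (count_space I)" and I: "finite I"
    and R_Z: "AE \<omega> in M. R \<omega> = r (Z \<omega>)"
    and prod: "\<And>z B. z \<in> I \<Longrightarrow> B \<in> sets T \<Longrightarrow>
      prob {\<omega> \<in> space M. Z \<omega> = z \<and> W \<omega> \<in> B} = w z * prob {\<omega> \<in> space M. W \<omega> \<in> B}"
  shows "indep_var S R T W"
proof -
  have ev: "{\<omega> \<in> space M. R \<omega> \<in> A \<and> W \<omega> \<in> B} \<in> events" if "A \<in> sets S" "B \<in> sets T" for A B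
    using measurable_sets[OF R that(1)] measurable_sets[OF W that(2)]
    by (intro sets.sets_Collect_conj) (simp_all add: vimage_def Int_def conj_commute)
  have evZ: "{\<omega> \<in> space M. Z \<omega> = z \<and> W \<omega> \<in> B} \<in> events" if "z \<in> I" "B \<in> sets T" for z B
    using measurable_sets[OF Z, of "{z}"] measurable_sets[OF W that(2)] that(1)
    by (intro sets.sets_Collect_conj) (simp_all add: vimage_def Int_def conj_commute)
  have ZI: "Z \<omega> \<in> I" if "\<omega> \<in> space M" for \<omega>
    using measurable_space[OF Z that] by simp
  \<comment> \<open>The null set where \<open>R\<close> differs from \<open>r\<close> applied to
    \<open>Z\<close> is absorbed here; the disjoint events for the values of \<open>Z\<close> are
    then summed.\<close>
  have joint: "prob {\<omega> \<in> space M. R \<omega> \<in> A \<and> W \<omega> \<in> B} =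
      (\<Sum>z\<in>{z \<in> I. r z \<in> A}. w z) * prob {\<omega> \<in> space M. W \<omega> \<in> B}"
    if A: "A \<in> sets S" and B: "B \<in> sets T" for A B
  proof -
    have "prob {\<omega> \<in> space M. R \<omega> \<in> A \<and> W \<omega> \<in> B} =
        prob (\<Union>z\<in>{z \<in> I. r z \<in> A}. {\<omega> \<in> space M. Z \<omega> = z \<and> W \<omega> \<in> B})"
    proof (rule finite_measure_eq_AE)
      show "AE \<omega> in M. (\<omega> \<in> {\<omega> \<in> space M. R \<omega> \<in> A \<and> W \<omega> \<in> B}) =
          (\<omega> \<in> (\<Union>z\<in>{z \<in> I. r z \<in> A}. {\<omega> \<in> space M. Z \<omega> = z \<and> W \<omega> \<in> B}))"
        using R_Z AE_space by eventually_elim (auto simp: ZI)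
      show "{\<omega> \<in> space M. R \<omega> \<in> A \<and> W \<omega> \<in> B} \<in> events" by (rule ev[OF A B])
      show "(\<Union>z\<in>{z \<in> I. r z \<in> A}. {\<omega> \<in> space M. Z \<omega> = z \<and> W \<omega> \<in> B}) \<in> events"
        using I evZ B by (intro sets.finite_UN) auto
    qed
    also have "\<dots> = (\<Sum>z\<in>{z \<in> I. r z \<in> A}. prob {\<omega> \<in> space M. Z \<omega> = z \<and> W \<omega> \<in> B})"
      using I evZ B by (intro finite_measure_finite_Union) (auto simp: disjoint_family_on_def)
    also have "\<dots> = (\<Sum>z\<in>{z \<in> I. r z \<in> A}. w z * prob {\<omega> \<in> space M. W \<omega> \<in> B})"
      using prod B by (intro sum.cong) auto
    finally show ?thesis by (simp add: sum_distrib_right)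
  qed
  \<comment> \<open>Taking the whole space for \<open>B\<close> identifies these sums of weights as
    the law of \<open>R\<close>, so the joint formula becomes a product of marginals.\<close>
  have marg: "prob {\<omega> \<in> space M. R \<omega> \<in> A} = (\<Sum>z\<in>{z \<in> I. r z \<in> A}. w z)" if A: "A \<in> sets S" for A
  proof -
    have "{\<omega> \<in> space M. R \<omega> \<in> A \<and> W \<omega> \<in> space T} = {\<omega> \<in> space M. R \<omega> \<in> A}"
      "{\<omega> \<in> space M. W \<omega> \<in> space T} = space M"
      using measurable_space[OF W] by auto
    then show ?thesis using joint[OF A sets.top] prob_space by simp
  qed
  have stable: "Int_stable {f -` A \<inter> space M |A. A \<in> sets L}" for L :: "'x measure" and f :: "'a \<Rightarrow> 'x"
  proof (rule Int_stableI)
    fix a b assume "a \<in> {f -` A \<inter> space M |A. A \<in> sets L}" "b \<in> {f -` A \<inter> space M |A. A \<in> sets L}"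
    then obtain A A' where "A \<in> sets L" "A' \<in> sets L" "a = f -` A \<inter> space M" "b = f -` A' \<inter> space M" by blast
    then show "a \<inter> b \<in> {f -` A \<inter> space M |A. A \<in> sets L}"
      by (intro CollectI exI[of _ "A \<inter> A'"]) auto
  qed
  have "indep_set {R -` A \<inter> space M |A. A \<in> sets S} {W -` A \<inter> space M |A. A \<in> sets T}"
    unfolding indep_sets2_eq
  proof (intro conjI ballI)
    show "{R -` A \<inter> space M |A. A \<in> sets S} \<subseteq> events" using measurable_sets[OF R] by blast
    show "{W -` A \<inter> space M |A. A \<in> sets T} \<subseteq> events" using measurable_sets[OF W] by blast
    fix a b assume "a \<in> {R -` A \<inter> space M |A. A \<in> sets S}" "b \<in> {W -` A \<inter> space M |A. A \<in> sets T}"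
    then obtain A B where AB: "A \<in> sets S" "B \<in> sets T" "a = R -` A \<inter> space M" "b = W -` B \<inter> space M" by blast
    have "a \<inter> b = {\<omega> \<in> space M. R \<omega> \<in> A \<and> W \<omega> \<in> B}" "a = {\<omega> \<in> space M. R \<omega> \<in> A}"
      "b = {\<omega> \<in> space M. W \<omega> \<in> B}"
      using AB by auto
    then show "prob (a \<inter> b) = prob a * prob b"
      using joint[OF AB(1,2)] marg[OF AB(1)] by simp
  qed
  from indep_set_sigma_sets[OF this stable stable] show ?thesis
    unfolding indep_var_eq using R W by blast
qed

text \<open>A product of equal factors is invariant under permuting its coordinates. The identity
  yields the law of the sample, the other permutations the laws of its reorderings.\<close>

lemma (in prob_space) distr_iid_permuted:
  fixes X :: "'i \<Rightarrow> 'a \<Rightarrow> 'b"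
  assumes I: "I \<noteq> {}" and X: "indep_vars (\<lambda>_. L) X I"
    and distr: "\<And>i. i \<in> I \<Longrightarrow> distr M L (X i) = U" and \<pi>: "\<pi> permutes I"
  shows "distr M (Pi\<^sub>M I (\<lambda>_. L)) (\<lambda>\<omega>. \<lambda>i\<in>I. X (\<pi> i) \<omega>) = Pi\<^sub>M I (\<lambda>_. U)"
proof -
  have rv: "random_variable L (X i)" if "i \<in> I" for i
    using X that by (auto simp: indep_vars_def)
  have U: "sets U = sets L" proof -
    obtain i where "i \<in> I" using I by blast
    from distr[OF this, symmetric] show ?thesis by simp
  qed
  have pU: "prob_space U" proof -
    obtain i where "i \<in> I" using I by blast
    then show ?thesis using prob_space_distr[OF rv] distr by metis
  qed
  have sets: "sets (Pi\<^sub>M I (\<lambda>_. U)) = sets (Pi\<^sub>M I (\<lambda>_. L))"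
    using U by (intro sets_PiM_cong) auto
  have id: "distr M (Pi\<^sub>M I (\<lambda>_. L)) (\<lambda>\<omega>. \<lambda>i\<in>I. X i \<omega>) = Pi\<^sub>M I (\<lambda>_. U)"
  proof -
    have "distr M (Pi\<^sub>M I (\<lambda>_. L)) (\<lambda>\<omega>. \<lambda>i\<in>I. X i \<omega>) = Pi\<^sub>M I (\<lambda>i. distr M L (X i))"
      using indep_vars_iff_distr_eq_PiM'[where X = X and M' = "\<lambda>_. L", OF I] rv X by blast
    also have "\<dots> = Pi\<^sub>M I (\<lambda>_. U)" using distr by (intro PiM_cong) auto
    finally show ?thesis .
  qed
  have meas: "(\<lambda>x. \<lambda>i\<in>I. x (\<pi> i)) \<in> measurable (Pi\<^sub>M I (\<lambda>_. L)) (Pi\<^sub>M I (\<lambda>_. L))"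
    using permutes_in_image[OF \<pi>] by (intro measurable_restrict measurable_component_singleton) auto
  have "Pi\<^sub>M I (\<lambda>_. U) = distr (Pi\<^sub>M I (\<lambda>_. U)) (Pi\<^sub>M I (\<lambda>_. U)) (\<lambda>x. \<lambda>i\<in>I. x (\<pi> i))"
    using permutes_inj_on[OF \<pi>] permutes_in_image[OF \<pi>] pU by (intro distr_PiM_reindex[symmetric]) auto
  also have "\<dots> = distr (distr M (Pi\<^sub>M I (\<lambda>_. L)) (\<lambda>\<omega>. \<lambda>i\<in>I. X i \<omega>)) (Pi\<^sub>M I (\<lambda>_. L)) (\<lambda>x. \<lambda>i\<in>I. x (\<pi> i))"
    unfolding id using sets by (intro distr_cong) auto
  also have "\<dots> = distr M (Pi\<^sub>M I (\<lambda>_. L)) ((\<lambda>x. \<lambda>i\<in>I. x (\<pi> i)) \<circ> (\<lambda>\<omega>. \<lambda>i\<in>I. X i \<omega>))"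
    using rv by (intro distr_distr meas measurable_restrict) auto
  also have "\<dots> = distr M (Pi\<^sub>M I (\<lambda>_. L)) (\<lambda>\<omega>. \<lambda>i\<in>I. X (\<pi> i) \<omega>)"
    using permutes_in_image[OF \<pi>] by (intro distr_cong) (auto simp: restrict_def)
  finally show ?thesis by simp
qed

section \<open>The law of the rearranged vector\<close>

context switching begin

text \<open>Translates the description by \<open>\<nu>\<close> into inequalities between values.
  Since \<open>x\<close> is injective with values in the open unit interval, the order statistics
  decrease strictly even with both end values attached, and the junction points of \<open>y\<close>
  are their values at \<open>p i\<close>.\<close>

lemma rearranging_perm_admissible:
  assumes x: "\<forall>i\<in>{1..n}. 0 < x i \<and> x i < 1" "inj_on x {1..n}"
    and \<nu>: "rearranging_perm n d p m B \<theta> (order_stat n x) \<nu>"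
    and y: "\<And>j. j \<in> {1..n} \<Longrightarrow> y j = order_stat n x (\<nu> j)"
  shows "admissible y" and "\<exists>\<pi>. \<pi> permutes {1..n} \<and> (\<forall>j\<in>{1..n}. y j = x (\<pi> j))"
proof -
  define s where "s = order_stat n x"
  obtain \<tau> where \<tau>: "\<tau> permutes {1..n}" and s\<tau>: "\<forall>l\<in>{1..n}. s l = x (\<tau> l)"
    unfolding s_def by (rule order_stat_permutation)
  have bij: "bij_betw \<nu> {1..n} {1..n}"
    and fix_p: "\<And>i. i \<in> {1..d} \<Longrightarrow> \<nu> (m i) = p i"
    and block: "\<And>i j. i \<in> {1..d + 1} \<Longrightarrow> j \<in> B i \<Longrightarrow> \<nu> j \<in> blockN p i"
    and mono: "\<And>i j j'. i \<in> {1..d + 1} \<Longrightarrow> j \<in> B i \<Longrightarrow> j' \<in> B i \<Longrightarrow> j < j' \<Longrightarrow>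
      block_jump p \<theta> s i (s (\<nu> j)) < block_jump p \<theta> s i (s (\<nu> j'))"
    using \<nu> B_in unfolding rearranging_perm_def s_def by blast+
  have y: "y j = s (\<nu> j)" if "j \<in> {1..n}" for j using y[OF that] by (simp add: s_def)
  have \<tau>n: "\<tau> l \<in> {1..n}" if "l \<in> {1..n}" for l using permutes_in_image[OF \<tau>] that by blast
  have s_ends: "s 0 = 1" "s (n + 1) = 0" by (simp_all add: s_def order_stat_def)
  have s_less: "s l' < s l" if ll: "l < l'" "l' \<le> n + 1" for l l'
  proof -
    have pos: "0 < s k" "s k < 1" if "k \<in> {1..n}" for k
      using s\<tau> x(1) \<tau>n[OF that] that by auto
    consider "l = 0" "l' = n + 1" | "l = 0" "l' \<in> {1..n}" | "l \<in> {1..n}" "l' = n + 1"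
      | "l \<in> {1..n}" "l' \<in> {1..n}"
      using ll by (cases "l = 0"; cases "l' = n + 1") auto
    then show ?thesis
    proof cases
      case 4
      have "s l' \<le> s l" unfolding s_def using 4 \<open>l < l'\<close> by (intro order_stat_antimono) auto
      moreover have "\<tau> l' \<noteq> \<tau> l" using permutes_inj[OF \<tau>] \<open>l < l'\<close> by (auto dest: injD)
      then have "s l' \<noteq> s l"
        using bspec[OF s\<tau> 4(1)] bspec[OF s\<tau> 4(2)] inj_on_eq_iff[OF x(2) \<tau>n[OF 4(2)] \<tau>n[OF 4(1)]] by simp
      ultimately show ?thesis by simp
    qed (use s_ends pos in auto)
  qed
  have p_ends: "p 0 = 0" "p (d + 1) = n + 1" and p_mono: "strict_mono_on {0..d + 1} p"
    using fixed by (auto simp: fixed_positions_def)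
  have p_less: "p (i - 1) < p i" "p i \<le> n + 1" if "i \<in> {1..d + 1}" for i
  proof -
    show "p (i - 1) < p i" using strict_mono_onD[OF p_mono, of "i - 1" i] that by auto
    show "p i \<le> n + 1"
      using strict_mono_onD[OF p_mono, of i "d + 1"] that p_ends by (cases "i = d + 1") auto
  qed
  \<comment> \<open>At the two ends this is the convention \<open>s 0 = 1\<close> and
    \<open>s (n + 1) = 0\<close>, matched by \<open>bound\<close> at \<open>0\<close> and
    \<open>d + 1\<close>.\<close>
  have bound: "bound y i = s (p i)" if i: "i \<le> d + 1" for i
  proof -
    consider "i = 0" | "i = d + 1" | "i \<in> {1..d}" using i by (cases "i = 0"; cases "i = d + 1") auto
    then show ?thesis
    proof cases
      case 3
      then show ?thesis using bound_m y[OF m_in] fix_p by simp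
    qed (use p_ends s_ends in \<open>simp_all add: bound_def\<close>)
  qed
  show "admissible y"
    unfolding admissible_def
  proof (intro conjI ballI impI)
    fix i assume i: "i \<in> {1..d + 1}"
    have b: "bound y i = s (p i)" "bound y (i - 1) = s (p (i - 1))" using bound i by auto
    show "bound y i < bound y (i - 1)" unfolding b using p_less[OF i] by (intro s_less) auto
    fix j assume j: "j \<in> B i"
    have \<nu>j: "p (i - 1) < \<nu> j" "\<nu> j < p i" using block[OF i j] by (auto simp: blockN_def)
    show "bound y i < y j" "y j < bound y (i - 1)"
      unfolding b y[OF B_in[OF i j]] using p_less[OF i] \<nu>j by (intro s_less; simp)+
    fix j' assume j': "j' \<in> B i" "j < j'"
    show "jump y i (y j) < jump y i (y j')"
      using mono[OF i j j'] unfolding block_jump_def comp_apply b y[OF B_in[OF i j]] y[OF B_in[OF i j'(1)]] .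
  qed
  \<comment> \<open>\<open>\<nu>\<close> selects a position in the sorted sample and
    \<open>\<tau>\<close> the sample index found there.\<close>
  define \<pi> where "\<pi> j = (if j \<in> {1..n} then \<tau> (\<nu> j) else j)" for j
  have "bij_betw (\<tau> \<circ> \<nu>) {1..n} {1..n}"
    using bij permutes_imp_bij[OF \<tau>] by (rule bij_betw_trans)
  then have "bij_betw \<pi> {1..n} {1..n}"
    by (rule bij_betw_cong[THEN iffD1, rotated]) (simp add: \<pi>_def)
  then have "\<pi> permutes {1..n}" by (rule bij_imp_permutes) (auto simp: \<pi>_def)
  moreover have "y j = x (\<pi> j)" if "j \<in> {1..n}" for j
    using y[OF that] s\<tau> bij_betwE[OF bij] that by (auto simp: \<pi>_def)
  ultimately show "\<exists>\<pi>. \<pi> permutes {1..n} \<and> (\<forall>j\<in>{1..n}. y j = x (\<pi> j))" by blast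
qed

text \<open>Splitting by the permutation that carries the sample to \<open>Y\<close> gives one event
  \<open>E \<pi>\<close> per permutation. These \<open>n!\<close> events are disjoint by uniqueness,
  and equally likely because every reordering of the sample has law \<open>N\<close>.\<close>

lemma rearrangement_law:
  assumes M: "prob_space M" and n: "n \<ge> 1"
    and X: "prob_space.indep_vars M (\<lambda>_. borel) X {1..n}"
    and unif: "\<And>i. i \<in> {1..n} \<Longrightarrow> distr M borel (X i) = unif"
    and Y: "(\<lambda>\<omega>. \<lambda>j\<in>{1..n}. Y j \<omega>) \<in> measurable M V"
    and perm: "AE \<omega> in M. admissible (\<lambda>j\<in>{1..n}. Y j \<omega>) \<and>
      (\<exists>\<pi>. \<pi> permutes {1..n} \<and> (\<forall>j\<in>{1..n}. Y j \<omega> = X (\<pi> j) \<omega>))"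
    and Q: "Measurable.pred V Q"
  shows "measure M {\<omega> \<in> space M. Q (\<lambda>j\<in>{1..n}. Y j \<omega>)} =
    fact n * measure N {y \<in> space N. admissible y \<and> Q y}"
proof -
  interpret prob_space M by fact
  define Z where "Z \<pi> \<omega> = (\<lambda>j\<in>{1..n}. X (\<pi> j) \<omega>)" for \<pi> \<omega>
  define E where "E \<pi> = {\<omega> \<in> space M. admissible (Z \<pi> \<omega>) \<and> Q (Z \<pi> \<omega>)}" for \<pi>
  let ?P = "{\<pi>. \<pi> permutes {1..n}}"
  have rv: "random_variable borel (X i)" if "i \<in> {1..n}" for i
    using X that by (auto simp: indep_vars_def)
  have Zm: "Z \<pi> \<in> measurable M V" if "\<pi> permutes {1..n}" for \<pi>
    unfolding Z_def using permutes_in_image[OF that] rv by (intro measurable_restrict) auto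
  have AQ: "{y \<in> space V. admissible y \<and> Q y} \<in> sets V"
    using pred_admissible Q unfolding pred_def by (intro sets.sets_Collect_conj)
  have E: "E \<pi> = Z \<pi> -` {y \<in> space V. admissible y \<and> Q y} \<inter> space M" if "\<pi> permutes {1..n}" for \<pi>
    using measurable_space[OF Zm[OF that]] by (auto simp: E_def)
  have E_ev: "E \<pi> \<in> events" if "\<pi> permutes {1..n}" for \<pi>
    unfolding E[OF that] using Zm[OF that] AQ by (rule measurable_sets)
  have prob_E: "prob (E \<pi>) = measure N {y \<in> space N. admissible y \<and> Q y}" if "\<pi> permutes {1..n}" for \<pi>
  proof -
    have "distr M V (Z \<pi>) = N"
      unfolding Z_def using n by (intro distr_iid_permuted X unif that) auto
    then have "measure N {y \<in> space V. admissible y \<and> Q y} = prob (E \<pi>)"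
      unfolding E[OF that] using measure_distr[OF Zm[OF that] AQ] by simp
    then show ?thesis by (simp only: space_N)
  qed
  have unique: "\<pi> = \<pi>'" if \<pi>: "\<pi> permutes {1..n}" "admissible (Z \<pi> \<omega>)"
    and \<pi>': "\<pi>' permutes {1..n}" "admissible (Z \<pi>' \<omega>)" for \<pi> \<pi>' \<omega>
  proof -
    \<comment> \<open>\<open>Z \<pi>'\<close> is \<open>Z \<pi>\<close> reordered by
      \<open>\<rho>\<close>, so \<open>admissible_perm_unique\<close> forces \<open>\<rho>\<close>
      to be the identity.\<close>
    define \<rho> where "\<rho> = inv \<pi> \<circ> \<pi>'"
    have \<rho>: "\<rho> permutes {1..n}"
      unfolding \<rho>_def using permutes_inv[OF \<pi>(1)] \<pi>'(1) by (rule permutes_compose[rotated])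
    have "Z \<pi> \<omega> (\<rho> j) = Z \<pi>' \<omega> j" if "j \<in> {1..n}" for j
    proof -
      have "\<rho> j \<in> {1..n}" using permutes_in_image[OF \<rho>] that by blast
      moreover have "\<pi> (\<rho> j) = \<pi>' j" using permutes_inverses(1)[OF \<pi>(1)] by (simp add: \<rho>_def)
      ultimately show ?thesis using that by (simp add: Z_def)
    qed
    then have "admissible (\<lambda>j. Z \<pi> \<omega> (\<rho> j)) = admissible (Z \<pi>' \<omega>)" by (rule admissible_cong)
    then have "admissible (\<lambda>j. Z \<pi> \<omega> (\<rho> j))" using \<pi>'(2) by simp
    from admissible_perm_unique[OF \<pi>(2) this \<rho>] have "\<pi> (inv \<pi> (\<pi>' j)) = \<pi> j" for j
      by (simp add: \<rho>_def fun_eq_iff)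
    then show ?thesis using permutes_inverses(1)[OF \<pi>(1)] by (simp add: fun_eq_iff)
  qed
  have "prob {\<omega> \<in> space M. Q (\<lambda>j\<in>{1..n}. Y j \<omega>)} = prob (\<Union>\<pi>\<in>?P. E \<pi>)"
  proof (rule finite_measure_eq_AE)
    show "AE \<omega> in M. (\<omega> \<in> {\<omega> \<in> space M. Q (\<lambda>j\<in>{1..n}. Y j \<omega>)}) = (\<omega> \<in> (\<Union>\<pi>\<in>?P. E \<pi>))"
      using perm AE_space
    proof eventually_elim
      case (elim \<omega>)
      then obtain \<pi> where \<pi>: "\<pi> permutes {1..n}" "\<forall>j\<in>{1..n}. Y j \<omega> = X (\<pi> j) \<omega>" by blast
      have YZ: "(\<lambda>j\<in>{1..n}. Y j \<omega>) = Z \<pi> \<omega>"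
        unfolding Z_def using \<pi>(2) by (intro restrict_ext) simp
      have adm: "admissible (Z \<pi> \<omega>)" using elim by (simp only: YZ)
      have sp: "\<omega> \<in> space M" using elim by blast
      \<comment> \<open>Admissibility singles out \<open>\<pi>\<close>, so the union collapses to
        one event.\<close>
      have "\<omega> \<in> (\<Union>\<pi>\<in>?P. E \<pi>) \<longleftrightarrow> \<omega> \<in> E \<pi>"
        using unique[OF \<pi>(1) adm] \<pi>(1) by (auto simp: E_def)
      also have "\<dots> \<longleftrightarrow> Q (Z \<pi> \<omega>)" using adm sp by (simp add: E_def)
      finally have U: "\<omega> \<in> (\<Union>\<pi>\<in>?P. E \<pi>) \<longleftrightarrow> Q (Z \<pi> \<omega>)" .
      have "Q (\<lambda>j\<in>{1..n}. Y j \<omega>) \<longleftrightarrow> Q (Z \<pi> \<omega>)" by (rule arg_cong[OF YZ])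
      then show ?case using sp unfolding U mem_Collect_eq by blast
    qed
    show "{\<omega> \<in> space M. Q (\<lambda>j\<in>{1..n}. Y j \<omega>)} \<in> events"
      using measurable_compose[OF Y Q] by (simp add: pred_def)
    show "(\<Union>\<pi>\<in>?P. E \<pi>) \<in> events"
      using E_ev by (intro sets.finite_UN finite_permutations) auto
  qed
  also have "\<dots> = (\<Sum>\<pi>\<in>?P. prob (E \<pi>))"
    using E_ev unique
    by (intro finite_measure_finite_Union finite_permutations)
      (auto simp: disjoint_family_on_def E_def)
  also have "\<dots> = (\<Sum>\<pi>\<in>?P. measure N {y \<in> space N. admissible y \<and> Q y})"
    using prob_E by (intro sum.cong) auto
  also have "\<dots> = fact n * measure N {y \<in> space N. admissible y \<and> Q y}"
    by (simp add: card_permutations)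
  finally show ?thesis .
qed

end

section \<open>Initial ranks and the final independence argument\<close>

lemma initial_rank_cong:
  assumes "\<And>i. i \<in> {1..j} \<Longrightarrow> y i = z i" "j \<ge> 1"
  shows "initial_rank y j = initial_rank z j"
proof -
  have "{i \<in> {1..<j}. y i > y j} = {i \<in> {1..<j}. z i > z j}" using assms by auto
  then show ?thesis by (simp add: initial_rank_def)
qed

lemma borel_measurable_initial_rank:
  assumes "\<And>i. i \<in> {1..j} \<Longrightarrow> Y i \<in> borel_measurable M" "j \<ge> 1"
  shows "(\<lambda>\<omega>. real (initial_rank (\<lambda>i. Y i \<omega>) j)) \<in> borel_measurable M"
proof -
  have "real (initial_rank y j) = 1 + (\<Sum>i\<in>{1..<j}. if y j < y i then 1 else 0)" for y
    by (simp add: initial_rank_def sum.If_cases Int_def)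
  moreover have "(\<lambda>\<omega>. 1 + (\<Sum>i\<in>{1..<j}. if Y j \<omega> < Y i \<omega> then 1 else 0 :: real)) \<in> borel_measurable M"
  proof (intro borel_measurable_add borel_measurable_const borel_measurable_sum measurable_If)
    fix i assume "i \<in> {1..<j}"
    then show "{\<omega> \<in> space M. Y j \<omega> < Y i \<omega>} \<in> sets M"
      using assms by (intro borel_measurable_less) auto
  qed
  ultimately show ?thesis by simp
qed

theorem proposition5:
  fixes M :: "'a measure"
    and X Y :: "nat \<Rightarrow> 'a \<Rightarrow> real"
    and n d :: nat
    and p m :: "nat \<Rightarrow> nat"
    and B :: "nat \<Rightarrow> nat set"
    and \<theta> :: "nat \<Rightarrow> real"
    and \<mu> :: "'a \<Rightarrow> nat \<Rightarrow> nat"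
  assumes "prob_space M"
    and "n \<ge> 1"
    and "prob_space.indep_vars M (\<lambda>_. borel) X {1..n}"
    and "\<And>i. i \<in> {1..n} \<Longrightarrow> distr M borel (X i) = uniform_measure lborel {0..1}"
    and "fixed_positions n d p"
    and "switching_scheme n d p m B"
    and "jump_probabilities d p \<theta>"
    and "\<And>j. j \<in> {1..n} \<Longrightarrow> (\<lambda>\<omega>. \<mu> \<omega> j) \<in> measurable M (count_space UNIV)"
    and "AE \<omega> in M. rearranging_perm n d p m B \<theta> (order_stat n (\<lambda>i. X i \<omega>)) (\<mu> \<omega>)"
    and "\<And>j \<omega>. j \<in> {1..n} \<Longrightarrow> \<omega> \<in> space M \<Longrightarrow>
           Y j \<omega> = order_stat n (\<lambda>i. X i \<omega>) (\<mu> \<omega> j)"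
  shows "strong_rank_independence M n Y"
proof -
  interpret prob_space M by fact
  interpret switching n d p m B \<theta> using assms(5-7) by unfold_locales
  have rvX: "random_variable borel (X i)" if "i \<in> {1..n}" for i
    using assms(3) that by (auto simp: indep_vars_def)
  have rvY: "random_variable borel (Y j)" if "j \<in> {1..n}" for j
  proof -
    \<comment> \<open>The index is itself random, but it takes countably many values.\<close>
    have "(\<lambda>\<omega>. order_stat n (\<lambda>i. X i \<omega>) (\<mu> \<omega> j)) \<in> borel_measurable M"
      by (rule measurable_compose_countable[OF borel_measurable_order_stat[OF rvX] assms(8)[OF that]])
    then show ?thesis using assms(10)[OF that] by (subst measurable_cong)
  qed
  define Yv where "Yv \<omega> = (\<lambda>j\<in>{1..n}. Y j \<omega>)" for \<omega>
  have Yv: "Yv \<in> measurable M V" unfolding Yv_def by (intro measurable_restrict rvY)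
  have "AE \<omega> in M. (\<forall>i\<in>{1..n}. 0 < X i \<omega> \<and> X i \<omega> < 1) \<and> inj_on (\<lambda>i. X i \<omega>) {1..n}"
  proof -
    have D: "distr M V (\<lambda>\<omega>. \<lambda>i\<in>{1..n}. X i \<omega>) = N"
      using distr_iid_permuted[OF _ assms(3,4) permutes_id] assms(2) by simp
    have "AE x in distr M V (\<lambda>\<omega>. \<lambda>i\<in>{1..n}. X i \<omega>). (\<forall>i\<in>{1..n}. 0 < x i \<and> x i < 1) \<and> inj_on x {1..n}"
      unfolding D by (rule AE_PiM_unif_distinct) simp
    moreover have "(\<lambda>\<omega>. \<lambda>i\<in>{1..n}. X i \<omega>) \<in> measurable M V"
      by (intro measurable_restrict rvX)
    ultimately have "AE \<omega> in M. (\<forall>i\<in>{1..n}. 0 < (\<lambda>i\<in>{1..n}. X i \<omega>) i \<and> (\<lambda>i\<in>{1..n}. X i \<omega>) i < 1) \<and>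
        inj_on (\<lambda>i\<in>{1..n}. X i \<omega>) {1..n}"
      by (rule AE_distrD[rotated])
    then show ?thesis by eventually_elim (simp add: inj_on_restrict_eq)
  qed
  then have perm: "AE \<omega> in M. admissible (\<lambda>j\<in>{1..n}. Y j \<omega>) \<and>
      (\<exists>\<pi>. \<pi> permutes {1..n} \<and> (\<forall>j\<in>{1..n}. Y j \<omega> = X (\<pi> j) \<omega>))"
    using assms(9) AE_space
  proof eventually_elim
    case (elim \<omega>)
    have "\<And>j. j \<in> {1..n} \<Longrightarrow> Y j \<omega> = order_stat n (\<lambda>i. X i \<omega>) (\<mu> \<omega> j)"
      using assms(10) elim by blast
    from rearranging_perm_admissible[OF _ _ elim(2) this] elim
    show ?case using admissible_cong[of "\<lambda>j\<in>{1..n}. Y j \<omega>" "\<lambda>j. Y j \<omega>"] by simp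
  qed
  have law: "prob {\<omega> \<in> space M. Q (Yv \<omega>)} = fact n * measure N {y \<in> space N. admissible y \<and> Q y}"
    if "Measurable.pred V Q" for Q
    unfolding Yv_def by (intro rearrangement_law[where X = X] assms(1-4) Yv[unfolded Yv_def] perm that)
  show ?thesis
    unfolding strong_rank_independence_def
  proof
    fix k assume k: "k \<in> {1..n - 1}"
    \<comment> \<open>Only block positions after \<open>k\<close> carry a random choice; the initial
      rank at a fixed position is prescribed by the levels.\<close>
    define K where "K = blocks \<inter> {k + 1..n}"
    have K: "finite K" "K \<subseteq> blocks" and Kn: "K \<subseteq> {1..n}" by (auto simp: K_def)
    define Z where "Z \<omega> = {j \<in> K. left (Yv \<omega>) j}" for \<omega>
    define W where "W \<omega> = (\<lambda>j\<in>{1..k}. Y j \<omega>)" for \<omega>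
    \<comment> \<open>By \<open>admissible_rank\<close>, \<open>r\<close> recovers all ranks after
      \<open>k\<close> from the set \<open>J\<close> of positions that went left.\<close>
    define r where "r J = (\<lambda>j\<in>{k + 1..n}. real (1 + card {i \<in> {1..<j}. level i < level j} +
      (if j \<in> J then card {i \<in> {1..<j}. level i = level j} else 0)))" for J
    \<comment> \<open>The weight of the pattern \<open>J\<close>; it involves the scheme and the
      jump probabilities but no values of \<open>Y\<close>.\<close>
    define w where "w J = (\<Prod>j\<in>K. if j \<in> J then \<theta> (blk j) else 1 - \<theta> (blk j))" for J
    have pattern: "Measurable.pred V (\<lambda>y. \<forall>j\<in>K. left y j = (j \<in> J))" for J
      by (rule pred_left_pattern[OF Kn])
    have Z_eq: "Z \<omega> = J \<longleftrightarrow> (\<forall>j\<in>K. left (Yv \<omega>) j = (j \<in> J))" if "J \<in> Pow K" for J \<omega>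
      using that by (auto simp: Z_def)
    have W_eq: "W \<omega> = restrict (Yv \<omega>) {1..k}" for \<omega>
      using k by (auto simp: W_def Yv_def restrict_def fun_eq_iff)
    show "indep_var (\<Pi>\<^sub>M j\<in>{k + 1..n}. borel) (\<lambda>\<omega>. \<lambda>j\<in>{k + 1..n}. real (initial_rank (\<lambda>i. Y i \<omega>) j))
        (\<Pi>\<^sub>M j\<in>{1..k}. borel) (\<lambda>\<omega>. \<lambda>j\<in>{1..k}. Y j \<omega>)"
      unfolding W_def[symmetric]
    proof (rule indep_var_of_finite_cases)
      show "(\<lambda>\<omega>. \<lambda>j\<in>{k + 1..n}. real (initial_rank (\<lambda>i. Y i \<omega>) j)) \<in> measurable M (\<Pi>\<^sub>M j\<in>{k + 1..n}. borel)"
        by (intro measurable_restrict borel_measurable_initial_rank rvY) auto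
      show "W \<in> measurable M (\<Pi>\<^sub>M j\<in>{1..k}. borel)"
        unfolding W_def using k by (intro measurable_restrict rvY) auto
      show "Z \<in> measurable M (count_space (Pow K))"
      proof (subst measurable_count_space_eq2, use K in simp, intro conjI ballI)
        show "Z \<in> space M \<rightarrow> Pow K" by (auto simp: Z_def)
        fix J assume J: "J \<in> Pow K"
        have "Z -` {J} \<inter> space M = {\<omega> \<in> space M. \<forall>j\<in>K. left (Yv \<omega>) j = (j \<in> J)}"
          by (intro set_eqI) (simp add: Z_eq[OF J] conj_commute)
        then show "Z -` {J} \<inter> space M \<in> events"
          using measurable_compose[OF Yv pattern[of J]] by (simp add: pred_def)
      qed
      show "finite (Pow K)" using K by simp
      show "AE \<omega> in M. (\<lambda>j\<in>{k + 1..n}. real (initial_rank (\<lambda>i. Y i \<omega>) j)) = r (Z \<omega>)"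
        using perm
      proof eventually_elim
        case (elim \<omega>)
        then have adm: "admissible (Yv \<omega>)" by (simp add: Yv_def)
        have "real (initial_rank (\<lambda>i. Y i \<omega>) j) = r (Z \<omega>) j" if j: "j \<in> {k + 1..n}" for j
        proof -
          have jn: "j \<in> {1..n}" using j by auto
          have "initial_rank (\<lambda>i. Y i \<omega>) j = initial_rank (Yv \<omega>) j"
            using j by (intro initial_rank_cong) (auto simp: Yv_def)
          also have "\<dots> = 1 + card {i \<in> {1..<j}. level i < level j} +
              (if j \<in> Z \<omega> then card {i \<in> {1..<j}. level i = level j} else 0)"
            unfolding admissible_rank[OF adm jn] using j by (auto simp: Z_def K_def)
          finally show ?thesis using j by (simp only: r_def restrict_apply if_True)
        qed
        then show ?case by (auto simp: r_def restrict_def fun_eq_iff)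
      qed
      fix J C assume J: "J \<in> Pow K" and C: "C \<in> sets (\<Pi>\<^sub>M j\<in>{1..k}. (borel :: real measure))"
      have res: "(\<lambda>y. restrict y {1..k}) \<in> measurable V (\<Pi>\<^sub>M j\<in>{1..k}. borel)"
        using k by (intro measurable_restrict_subset) auto
      have predC: "Measurable.pred V (\<lambda>y. restrict y {1..k} \<in> C)"
        using measurable_sets[OF res C] by (simp add: pred_def vimage_def Int_def conj_commute)
      have "prob {\<omega> \<in> space M. Z \<omega> = J \<and> W \<omega> \<in> C} =
          prob {\<omega> \<in> space M. restrict (Yv \<omega>) {1..k} \<in> C \<and> (\<forall>j\<in>K. left (Yv \<omega>) j = (j \<in> J))}"
        by (simp only: Z_eq[OF J] W_eq conj_commute)
      also have "\<dots> = fact n * measure N {y \<in> space N. admissible y \<and>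
          restrict y {1..k} \<in> C \<and> (\<forall>j\<in>K. left y j = (j \<in> J))}"
        using pattern predC by (intro law) (auto intro: pred_intros_logic)
      also have "measure N {y \<in> space N. admissible y \<and> restrict y {1..k} \<in> C \<and> (\<forall>j\<in>K. left y j = (j \<in> J))} =
          w J * measure N {y \<in> space N. admissible y \<and> restrict y {1..k} \<in> C}"
        unfolding w_def
      proof (intro measure_left_pattern K predC)
        \<comment> \<open>\<open>C\<close> reads the coordinates up to \<open>k\<close>, while
          \<open>K\<close> starts at \<open>k + 1\<close>.\<close>
        fix y :: "nat \<Rightarrow> real" and j t assume "j \<in> K"
        then have "restrict (y(j := t)) {1..k} = restrict y {1..k}"
          by (auto simp: K_def restrict_def fun_eq_iff)
        then show "(restrict (y(j := t)) {1..k} \<in> C) = (restrict y {1..k} \<in> C)" by simp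
      qed
      \<comment> \<open>The law of \<open>Y\<close> is now used in the reverse direction, which
        absorbs the factor \<open>fact n\<close>.\<close>
      also have "fact n * (w J * measure N {y \<in> space N. admissible y \<and> restrict y {1..k} \<in> C}) =
          w J * prob {\<omega> \<in> space M. restrict (Yv \<omega>) {1..k} \<in> C}"
        by (simp only: law[OF predC] mult.left_commute)
      finally show "prob {\<omega> \<in> space M. Z \<omega> = J \<and> W \<omega> \<in> C} = w J * prob {\<omega> \<in> space M. W \<omega> \<in> C}"
        by (simp only: W_eq)
    qed
  qed
qed

end
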